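(* Let $F$ be a connected closed manifold of dimension $n\ge 1$, let $\{g_t\}_{t\in\mathbb{R}}$ be a smooth family of Riemannian metrics on $F$, and let $M^{1,n}$ be the Lorentzian manifold $(\mathbb{R}\times F,\ h_{M^{1,n}}=-dt^2+g_t)$. Assume that there exist positive constants $t_0$ and $c$ such that $\partial_{|t|}g_t(X,X)\ge 2c\,g_t(X,X)$ for every vector field $X$ on $F$ and every $t$ with $|t|\ge t_0$. Then the Calabi--Markus phenomenon occurs in $M^{1,n}$; that is, no group other than a finite one can act isometrically, effectively, and properly discontinuously on $M^{1,n}$.
   Context: Closed manifold means compact without boundary. $\partial_t$ is the partial derivative in the direction $t$, and for $t\ne 0$ the signed derivative is $\partial_{|t|}=(t/|t|)\,\partial_t$. An action of a group $\Gamma$ on a manifold $M$ is properly discontinuous if for every compact subset $K\subset M$ only finitely many $\phi\in\Gamma$ satisfy $\phi(K)\cap K\neq\emptyset$. The Calabi--Markus phenomenon is said to occur in a pseudo-Riemannian manifold if no groups but finite ones can act isometrically, effectively, and properly discontinuously on it. *)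

theory Defs
  imports "HOL-Analysis.Analysis" "HOL-Algebra.Group_Action"
begin

section \<open>Smooth maps between Euclidean spaces\<close>

text \<open>Intended for open \<open>S\<close>; \<open>frechet_derivative f (at x) b\<close> with \<open>b \<in> Basis\<close> is the partial
  derivative of \<open>f\<close> at \<open>x\<close> in the direction \<open>b\<close>.\<close>

primrec C_on :: "nat \<Rightarrow> 'a::euclidean_space set \<Rightarrow> ('a \<Rightarrow> 'b::real_normed_vector) \<Rightarrow> bool" where
  "C_on 0 S f \<longleftrightarrow> continuous_on S f"
| "C_on (Suc k) S f \<longleftrightarrow> (\<forall>x\<in>S. f differentiable (at x)) \<and>
     (\<forall>b\<in>Basis. C_on k S (\<lambda>x. frechet_derivative f (at x) b))"

definition smooth_on :: "'a::euclidean_space set \<Rightarrow> ('a \<Rightarrow> 'b::real_normed_vector) \<Rightarrow> bool" where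
  "smooth_on S f \<longleftrightarrow> (\<forall>k. C_on k S f)"


section \<open>Smooth manifolds\<close>

text \<open>A chart is a pair \<open>(U, \<phi>)\<close>; only the values of \<open>\<phi>\<close> on \<open>U\<close> are meaningful. A smooth manifold is
  a topological space \<open>X\<close> with a (not necessarily maximal) smooth atlas \<open>A\<close>. It has no boundary,
  and its dimension is \<open>DIM('e)\<close>, which is always at least \<open>1\<close>.\<close>

type_synonym ('a, 'e) chart = "'a set \<times> ('a \<Rightarrow> 'e)"

definition chart_inv :: "('a, 'e) chart \<Rightarrow> 'e \<Rightarrow> 'a" where
  "chart_inv c = inv_into (fst c) (snd c)"

definition smooth_manifold :: "'a topology \<Rightarrow> ('a, 'e::euclidean_space) chart set \<Rightarrow> bool" where
  "smooth_manifold X A \<longleftrightarrow>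
     Hausdorff_space X \<and> second_countable X \<and>
     (\<Union>c\<in>A. fst c) = topspace X \<and>
     (\<forall>c\<in>A. openin X (fst c) \<and> open (snd c ` fst c) \<and>
        homeomorphic_map (subtopology X (fst c)) (top_of_set (snd c ` fst c)) (snd c)) \<and>
     (\<forall>c\<in>A. \<forall>d\<in>A. smooth_on (snd c ` (fst c \<inter> fst d)) (snd d \<circ> chart_inv c))"

definition smooth_map :: "'a topology \<Rightarrow> ('a, 'e::euclidean_space) chart set \<Rightarrow>
    'b topology \<Rightarrow> ('b, 'f::euclidean_space) chart set \<Rightarrow> ('a \<Rightarrow> 'b) \<Rightarrow> bool" where
  "smooth_map X A Y B f \<longleftrightarrow> continuous_map X Y f \<and>
     (\<forall>c\<in>A. \<forall>d\<in>B. smooth_on (snd c ` (fst c \<inter> f -` fst d)) (snd d \<circ> f \<circ> chart_inv c))"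

definition diffeomorphism :: "'a topology \<Rightarrow> ('a, 'e::euclidean_space) chart set \<Rightarrow>
    'b topology \<Rightarrow> ('b, 'f::euclidean_space) chart set \<Rightarrow> ('a \<Rightarrow> 'b) \<Rightarrow> bool" where
  "diffeomorphism X A Y B f \<longleftrightarrow> bij_betw f (topspace X) (topspace Y) \<and>
     smooth_map X A Y B f \<and> smooth_map Y B X A (inv_into (topspace X) f)"


section \<open>Tangent vectors, differentials and vector fields\<close>

text \<open>A tangent vector at \<open>p\<close> is the family of its coordinate vectors in all the charts around \<open>p\<close>,
  where any two coordinate vectors are related by the derivative of the change of charts.
  The family is \<open>0\<close> at all other arguments, so that equality of tangent vectors is equality of
  functions.\<close>

type_synonym ('a, 'e) tvec = "('a, 'e) chart \<Rightarrow> 'e"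

definition charts_at :: "('a, 'e) chart set \<Rightarrow> 'a \<Rightarrow> ('a, 'e) chart set" where
  "charts_at A p = {c \<in> A. p \<in> fst c}"

definition tangent_space :: "('a, 'e::euclidean_space) chart set \<Rightarrow> 'a \<Rightarrow> ('a, 'e) tvec set" where
  "tangent_space A p = {v.
     (\<forall>c\<in>charts_at A p. \<forall>d\<in>charts_at A p.
        v d = frechet_derivative (snd d \<circ> chart_inv c) (at (snd c p)) (v c)) \<and>
     (\<forall>c. c \<notin> charts_at A p \<longrightarrow> v c = 0)}"

definition coord_tvec ::
    "('a, 'e::euclidean_space) chart set \<Rightarrow> ('a, 'e) chart \<Rightarrow> 'a \<Rightarrow> 'e \<Rightarrow> ('a, 'e) tvec" where
  \<comment> \<open>the tangent vector at \<open>p\<close> whose coordinate vector in the chart \<open>c\<close> is \<open>u\<close>\<close>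
  "coord_tvec A c p u = (\<lambda>d. if d \<in> charts_at A p
     then frechet_derivative (snd d \<circ> chart_inv c) (at (snd c p)) u else 0)"

definition differential :: "('a, 'e::euclidean_space) chart set \<Rightarrow>
    ('b, 'f::euclidean_space) chart set \<Rightarrow> ('a \<Rightarrow> 'b) \<Rightarrow> 'a \<Rightarrow> ('a, 'e) tvec \<Rightarrow> ('b, 'f) tvec" where
  \<comment> \<open>for smooth \<open>f\<close> this does not depend on the chart \<open>c\<close> chosen around \<open>p\<close>, by the chain rule\<close>
  "differential A B f p v = (\<lambda>d. if d \<in> charts_at B (f p)
     then let c = (SOME c. c \<in> charts_at A p)
          in frechet_derivative (snd d \<circ> f \<circ> chart_inv c) (at (snd c p)) (v c)
     else 0)"

definition smooth_vector_field ::
    "'a topology \<Rightarrow> ('a, 'e::euclidean_space) chart set \<Rightarrow> ('a \<Rightarrow> ('a, 'e) tvec) \<Rightarrow> bool" where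
  "smooth_vector_field X A V \<longleftrightarrow> (\<forall>p\<in>topspace X. V p \<in> tangent_space A p) \<and>
     (\<forall>c\<in>A. smooth_on (snd c ` fst c) (\<lambda>x. V (chart_inv c x) c))"


section \<open>Metrics and isometries\<close>

text \<open>A metric sends a point \<open>p\<close> and two tangent vectors at \<open>p\<close> to a real number.\<close>

type_synonym ('a, 'e) metric = "'a \<Rightarrow> ('a, 'e) tvec \<Rightarrow> ('a, 'e) tvec \<Rightarrow> real"

definition symmetric_bilinear_on_tangents ::
    "'a topology \<Rightarrow> ('a, 'e::euclidean_space) chart set \<Rightarrow> ('a, 'e) metric \<Rightarrow> bool" where
  "symmetric_bilinear_on_tangents X A g \<longleftrightarrow>
     (\<forall>p\<in>topspace X. \<forall>u\<in>tangent_space A p. \<forall>v\<in>tangent_space A p.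
        g p u v = g p v u \<and>
        (\<forall>w\<in>tangent_space A p. \<forall>a b::real.
           g p (\<lambda>c. a *\<^sub>R u c + b *\<^sub>R v c) w = a * g p u w + b * g p v w))"

definition riemannian_metric ::
    "'a topology \<Rightarrow> ('a, 'e::euclidean_space) chart set \<Rightarrow> ('a, 'e) metric \<Rightarrow> bool" where
  "riemannian_metric X A g \<longleftrightarrow>
     symmetric_bilinear_on_tangents X A g \<and>
     (\<forall>p\<in>topspace X. \<forall>v\<in>tangent_space A p. v \<noteq> (\<lambda>c. 0) \<longrightarrow> g p v v > 0) \<and>
     (\<forall>c\<in>A. \<forall>u v. smooth_on (snd c ` fst c)
        (\<lambda>x. let p = chart_inv c x in g p (coord_tvec A c p u) (coord_tvec A c p v)))"

text \<open>The components of the metrics are jointly smooth in the parameter \<open>t\<close> and the point of \<open>F\<close>.\<close>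

definition smooth_family_of_metrics ::
    "'a topology \<Rightarrow> ('a, 'e::euclidean_space) chart set \<Rightarrow> (real \<Rightarrow> ('a, 'e) metric) \<Rightarrow> bool" where
  "smooth_family_of_metrics X A g \<longleftrightarrow>
     (\<forall>t. riemannian_metric X A (g t)) \<and>
     (\<forall>c\<in>A. \<forall>u v. smooth_on (UNIV \<times> snd c ` fst c)
        (\<lambda>(t, x). let p = chart_inv c x in g t p (coord_tvec A c p u) (coord_tvec A c p v)))"

definition isometry ::
    "'a topology \<Rightarrow> ('a, 'e::euclidean_space) chart set \<Rightarrow> ('a, 'e) metric \<Rightarrow> ('a \<Rightarrow> 'a) \<Rightarrow> bool" where
  "isometry X A h f \<longleftrightarrow> diffeomorphism X A X A f \<and>
     (\<forall>p\<in>topspace X. \<forall>u\<in>tangent_space A p. \<forall>v\<in>tangent_space A p.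
        h (f p) (differential A A f p u) (differential A A f p v) = h p u v)"


section \<open>The Lorentzian manifold \<open>(\<real> \<times> F, - dt\<^sup>2 + g\<^sub>t)\<close>\<close>

definition product_atlas :: "('a, 'e) chart set \<Rightarrow> ('b, 'f) chart set \<Rightarrow>
    ('a \<times> 'b, 'e \<times> 'f) chart set" where
  "product_atlas A B = {(fst c \<times> fst d, map_prod (snd c) (snd d)) |c d. c \<in> A \<and> d \<in> B}"

definition real_line_atlas :: "(real, real) chart set" where
  "real_line_atlas = {(UNIV, id)}"

abbreviation spacetime_topology :: "'a topology \<Rightarrow> (real \<times> 'a) topology" where
  "spacetime_topology X \<equiv> prod_topology euclideanreal X"

abbreviation spacetime_atlas ::
    "('a, 'e::euclidean_space) chart set \<Rightarrow> (real \<times> 'a, real \<times> 'e) chart set" where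
  "spacetime_atlas A \<equiv> product_atlas real_line_atlas A"

definition dt :: "('a, 'e::euclidean_space) chart set \<Rightarrow> real \<times> 'a \<Rightarrow>
    (real \<times> 'a, real \<times> 'e) tvec \<Rightarrow> real" where
  "dt A q v = differential (spacetime_atlas A) real_line_atlas fst q v (UNIV, id)"

definition lorentz_metric :: "('a, 'e::euclidean_space) chart set \<Rightarrow> (real \<Rightarrow> ('a, 'e) metric) \<Rightarrow>
    (real \<times> 'a, real \<times> 'e) metric" where
  "lorentz_metric A g q u v = - (dt A q u * dt A q v) +
     g (fst q) (snd q) (differential (spacetime_atlas A) A snd q u)
                       (differential (spacetime_atlas A) A snd q v)"

definition deriv_abs :: "(real \<Rightarrow> real) \<Rightarrow> real \<Rightarrow> real" where
  \<comment> \<open>the signed derivative \<open>\<partial>\<^bsub>|t|\<^esub>\<close>, meaningful for \<open>t \<noteq> 0\<close>\<close>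
  "deriv_abs f t = (t / \<bar>t\<bar>) * deriv f t"


section \<open>The Calabi--Markus phenomenon\<close>

definition acts_isometrically :: "'a topology \<Rightarrow> ('a, 'e::euclidean_space) chart set \<Rightarrow>
    ('a, 'e) metric \<Rightarrow> 'g monoid \<Rightarrow> ('g \<Rightarrow> 'a \<Rightarrow> 'a) \<Rightarrow> bool" where
  "acts_isometrically X A h G \<phi> \<longleftrightarrow>
     group_action G (topspace X) \<phi> \<and> (\<forall>\<gamma>\<in>carrier G. isometry X A h (\<phi> \<gamma>))"

definition properly_discontinuous ::
    "'a topology \<Rightarrow> 'g monoid \<Rightarrow> ('g \<Rightarrow> 'a \<Rightarrow> 'a) \<Rightarrow> bool" where
  "properly_discontinuous X G \<phi> \<longleftrightarrow>
     (\<forall>K. compactin X K \<longrightarrow> finite {\<gamma> \<in> carrier G. \<phi> \<gamma> ` K \<inter> K \<noteq> {}})"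

text \<open>The type argument is the element type of the acting groups: a definition cannot quantify over
  it, but theorems are polymorphic in it.\<close>

definition calabi_markus_phenomenon :: "'g itself \<Rightarrow> 'a topology \<Rightarrow>
    ('a, 'e::euclidean_space) chart set \<Rightarrow> ('a, 'e) metric \<Rightarrow> bool" where
  "calabi_markus_phenomenon (_ :: 'g itself) X A h \<longleftrightarrow>
     (\<forall>(G :: 'g monoid) \<phi>. acts_isometrically X A h G \<phi> \<and>
        faithful_action G (topspace X) \<phi> \<and> properly_discontinuous X G \<phi>
        \<longrightarrow> finite (carrier G))"

end

theory Submission
  imports Defs
begin

text \<open>
  Every isometry \<open>f\<close> of the spacetime meets its core \<open>K = [- t0, t0] \<times> F\<close> again: \<open>f K \<inter> K\<close> is not empty,
  unless \<open>F\<close> is (lemma \<open>isometry_meets_core\<close>). Since \<open>K\<close> is compact, a properly discontinuous group of isometries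
  is then finite.

  To see why, suppose that \<open>f = (\<tau>, \<psi>)\<close> displaces \<open>K\<close>. As \<open>K\<close> is connected, \<open>f\<close> maps it into one end, say into
  the times \<open>> t0\<close>. Let \<open>z\<close> be a point where \<open>\<tau>\<close> attains its minimum over \<open>K\<close>. Along the slice of
  constant time through \<open>z\<close> the function \<open>\<tau>\<close> is critical, so \<open>f\<close> maps this slice to a hypersurface tangent to a
  slice at \<open>f z\<close>, and the unit normal \<open>\<partial>\<^sub>t\<close> at \<open>z\<close> to \<open>\<epsilon> \<partial>\<^sub>t\<close> with \<open>\<epsilon> = \<plusminus>1\<close>. In particular \<open>\<tau>\<close> is strictly
  monotone in time at \<open>z\<close>, so that \<open>z\<close> lies at time \<open>\<plusminus>t0\<close>, and \<open>f\<close> sends the outward normal of \<open>K\<close> at \<open>z\<close> to the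
  past-directed one. At \<open>z\<close> the slices expand outwards; their image therefore contracts towards the
  future, whereas the slice through \<open>f z\<close> expands towards the future. But the image touches that slice from
  the future side, so it expands at least as fast as the slice does, a contradiction. (If \<open>f\<close> maps \<open>K\<close> into
  the past end, the same argument applies with time reversed.)

  This comparison of second fundamental forms is obtained without connections or geodesics, by
  differentiating the isometry equation once in a pair of charts
  (\<open>second_order_identity\<close>), where the symmetry of second derivatives eliminates the derivatives of \<open>\<psi>\<close> and
  leaves the Hessian of \<open>\<tau>\<close> along the slice, whose sign at a minimum is known. Two preparations link this
  to manifolds: differentials and the Lorentzian metric are expressed in a fixed chart around the
  point, and single tangent vectors are extended to global vector fields by bump functions, since the
  growth of the metrics is assumed for vector fields.
\<close>

section \<open>Calculus of continuously differentiable maps\<close>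

lemma frechet_derivative_eqI:
  "(f has_derivative f') (at x) \<Longrightarrow> frechet_derivative f (at x) = f'"
  using frechet_derivative_at by metis

text \<open>Openness of the domain is essential here: the derivative at a point of \<open>S\<close> is the two-sided one in the
  ambient space, so it only depends on the values on \<open>S\<close> if \<open>S\<close> is a neighbourhood of the point.\<close>

lemma C_on_cong:
  assumes "open S" "\<And>x. x \<in> S \<Longrightarrow> f x = g x" "C_on k S f"
  shows "C_on k S g"
  using assms(2,3)
proof (induction k arbitrary: f g)
  case 0
  then have "continuous_on S f" by simp
  then have "continuous_on S g"
    by (rule continuous_on_eq) (rule 0)
  then show ?case by simp
next
  case (Suc k)
  have g: "(g has_derivative frechet_derivative f (at x)) (at x)" if "x \<in> S" for x
    using Suc.prems that assms(1)
    by (auto simp: frechet_derivative_works intro: has_derivative_transform_within_open)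
  show ?case unfolding C_on.simps
  proof (intro conjI ballI)
    show "g differentiable (at x)" if "x \<in> S" for x
      using g[OF that] by (auto simp: differentiable_def)
    show "C_on k S (\<lambda>x. frechet_derivative g (at x) b)" if "b \<in> Basis" for b
      by (rule Suc.IH[of "\<lambda>x. frechet_derivative f (at x) b"])
        (use frechet_derivative_eqI[OF g] Suc.prems that in auto)
  qed
qed

lemma C_on_Suc_intro:
  assumes "open S" and "\<And>x. x \<in> S \<Longrightarrow> (f has_derivative f' x) (at x)"
    and "\<And>b. b \<in> Basis \<Longrightarrow> C_on k S (\<lambda>x. f' x b)"
  shows "C_on (Suc k) S f"
  unfolding C_on.simps
proof (intro conjI ballI)
  show "f differentiable (at x)" if "x \<in> S" for x
    using assms(2)[OF that] by (auto simp: differentiable_def)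
  show "C_on k S (\<lambda>x. frechet_derivative f (at x) b)" if "b \<in> Basis" for b
    by (rule C_on_cong[OF assms(1) _ assms(3)[OF that]]) (simp add: frechet_derivative_eqI[OF assms(2)])
qed

lemma C_on_lower: "C_on (Suc k) S f \<Longrightarrow> C_on k S f"
proof (induction k arbitrary: f)
  case 0
  then show ?case
    by (auto intro!: continuous_at_imp_continuous_on differentiable_imp_continuous_within)
next
  case (Suc k)
  then show ?case by (metis C_on.simps(2))
qed

lemma C_on_subset: "C_on k S f \<Longrightarrow> T \<subseteq> S \<Longrightarrow> C_on k T f"
  by (induction k arbitrary: f) (auto intro: continuous_on_subset)

text \<open>Lets a map be proved smooth by cases on the point, with a different formula near each point.\<close>

lemma C_on_local:
  assumes "\<And>x. x \<in> S \<Longrightarrow> \<exists>T. open T \<and> x \<in> T \<and> C_on k T f"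
  shows "C_on k S f"
  using assms
proof (induction k arbitrary: f)
  case 0
  show ?case
    using 0 by (metis C_on.simps(1) continuous_at_imp_continuous_on continuous_on_eq_continuous_at)
next
  case (Suc k)
  show ?case unfolding C_on.simps
  proof (intro conjI ballI)
    show "f differentiable (at x)" if "x \<in> S" for x
      using Suc.prems[OF that] by auto
    show "C_on k S (\<lambda>x. frechet_derivative f (at x) b)" if "b \<in> Basis" for b
      by (rule Suc.IH) (use Suc.prems that in \<open>force\<close>)
  qed
qed

lemma C_on_const [intro]: "open S \<Longrightarrow> C_on k S (\<lambda>x. c)"
proof (induction k arbitrary: c)
  case (Suc k)
  show ?case
    by (rule C_on_Suc_intro[where f' = "\<lambda>_ _. 0"]) (use Suc in auto)
qed auto

lemma C_on_linear:
  assumes "bounded_linear L" "open S" "C_on k S f"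
  shows "C_on k S (\<lambda>x. L (f x))"
  using assms(3)
proof (induction k arbitrary: f)
  case 0
  then show ?case using assms(1) by (simp add: bounded_linear.continuous_on)
next
  case (Suc k)
  show ?case
    by (rule C_on_Suc_intro[where f' = "\<lambda>x h. L (frechet_derivative f (at x) h)"])
      (use Suc assms in \<open>auto simp: frechet_derivative_works intro: bounded_linear.has_derivative\<close>)
qed

lemma C_on_id: "open S \<Longrightarrow> C_on k S (\<lambda>x. x)"
proof (induction k)
  case (Suc k)
  show ?case
    by (rule C_on_Suc_intro[where f' = "\<lambda>_ h. h"]) (use Suc in auto)
qed auto

lemma C_on_bounded_linear: "bounded_linear L \<Longrightarrow> open S \<Longrightarrow> C_on k S L"
  using C_on_linear[OF _ _ C_on_id] by blast

lemma C_on_add: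
  assumes "open S" "C_on k S f" "C_on k S g"
  shows "C_on k S (\<lambda>x. f x + g x)"
  using assms(2,3)
proof (induction k arbitrary: f g)
  case (Suc k)
  show ?case
    by (rule C_on_Suc_intro[where f' = "\<lambda>x h. frechet_derivative f (at x) h + frechet_derivative g (at x) h"])
      (use Suc assms(1) in \<open>auto simp: frechet_derivative_works intro: has_derivative_add\<close>)
qed (auto intro: continuous_intros)

lemma C_on_sum:
  assumes "open S" "\<And>i. i \<in> I \<Longrightarrow> C_on k S (f i)"
  shows "C_on k S (\<lambda>x. \<Sum>i\<in>I. f i x)"
  using assms(2)
  by (induction I rule: infinite_finite_induct) (auto intro: C_on_add assms(1))

lemma C_on_bilinear:
  assumes "bounded_bilinear B" "open S" "C_on k S f" "C_on k S g"
  shows "C_on k S (\<lambda>x. B (f x) (g x))"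
  using assms(3,4)
proof (induction k arbitrary: f g)
  case 0
  then show ?case using bounded_bilinear.continuous_on[OF assms(1)] by auto
next
  case (Suc k)
  show ?case
  proof (rule C_on_Suc_intro[where f' = "\<lambda>x h. B (f x) (frechet_derivative g (at x) h)
                                        + B (frechet_derivative f (at x) h) (g x)", OF assms(2)])
    show "((\<lambda>x. B (f x) (g x)) has_derivative (\<lambda>h. B (f x) (frechet_derivative g (at x) h)
                                        + B (frechet_derivative f (at x) h) (g x))) (at x)"
      if "x \<in> S" for x
      using Suc.prems that
      by (auto simp: frechet_derivative_works intro!: bounded_bilinear.FDERIV[OF assms(1)])
    show "C_on k S (\<lambda>x. B (f x) (frechet_derivative g (at x) b) + B (frechet_derivative f (at x) b) (g x))"
      if "b \<in> Basis" for b
      using Suc.prems that C_on_lower[OF Suc.prems(1)] C_on_lower[OF Suc.prems(2)]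
      by (intro C_on_add assms(2) Suc.IH) (auto simp del: C_on.simps(1))
  qed
qed

lemma linear_basis_expansion:
  fixes L :: "'a::euclidean_space \<Rightarrow> 'b::real_vector"
  assumes "linear L"
  shows "L u = (\<Sum>i\<in>Basis. (u \<bullet> i) *\<^sub>R L i)"
proof -
  have "L u = L (\<Sum>i\<in>Basis. (u \<bullet> i) *\<^sub>R i)" by (simp add: euclidean_representation)
  also have "\<dots> = (\<Sum>i\<in>Basis. (u \<bullet> i) *\<^sub>R L i)" using assms by (simp add: linear_sum linear_cmul)
  finally show ?thesis .
qed

lemma C_on_directional_derivative:
  assumes "open S" "C_on (Suc k) S f" "C_on k S u"
  shows "C_on k S (\<lambda>x. frechet_derivative f (at x) (u x))"
proof (rule C_on_cong[OF assms(1)])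
  show "C_on k S (\<lambda>x. \<Sum>i\<in>Basis. (u x \<bullet> i) *\<^sub>R frechet_derivative f (at x) i)"
    by (intro C_on_sum C_on_bilinear[OF bounded_bilinear_scaleR] C_on_linear[OF bounded_linear_inner_left])
      (use assms in auto)
  show "(\<Sum>i\<in>Basis. (u x \<bullet> i) *\<^sub>R frechet_derivative f (at x) i) = frechet_derivative f (at x) (u x)"
    if "x \<in> S" for x
    using assms that by (auto intro!: linear_basis_expansion[symmetric] linear_frechet_derivative)
qed

text \<open>In coordinates the chain rule reads \<open>D(g \<circ> f) b = (\<Sum>i\<in>Basis. (Df b \<bullet> i) *\<^sub>R (\<partial>\<^sub>i g \<circ> f))\<close>; the partial
  derivatives \<open>\<partial>\<^sub>i g\<close> have one derivative less than \<open>g\<close>, so that the induction hypothesis applies to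
  their compositions with \<open>f\<close>.\<close>

lemma C_on_compose:
  assumes "open S" "open T" "f ` S \<subseteq> T" "C_on k S f" "C_on k T g"
  shows "C_on k S (g \<circ> f)"
  using assms(4,5)
proof (induction k arbitrary: g)
  case 0
  then have "continuous_on S f" "continuous_on T g" by auto
  then show ?case
    using assms(3) unfolding C_on.simps(1)
    by (metis continuous_on_compose continuous_on_subset)
next
  case (Suc k)
  have f': "(f has_derivative frechet_derivative f (at x)) (at x)" if "x \<in> S" for x
    using Suc.prems that by (auto simp: frechet_derivative_works)
  have g': "(g has_derivative frechet_derivative g (at (f x))) (at (f x))" if "x \<in> S" for x
    using Suc.prems that assms(3) by (auto simp: frechet_derivative_works)
  have *: "frechet_derivative g (at (f x)) u = (\<Sum>i\<in>Basis. (u \<bullet> i) *\<^sub>R frechet_derivative g (at (f x)) i)" 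
    if "x \<in> S" for x u
    using g'[OF that] by (intro linear_basis_expansion) (simp add: has_derivative_linear)
  show ?case
  proof (rule C_on_Suc_intro[OF assms(1)])
    show "((g \<circ> f) has_derivative (\<lambda>h. \<Sum>i\<in>Basis. (frechet_derivative f (at x) h \<bullet> i) *\<^sub>R 
           frechet_derivative g (at (f x)) i)) (at x)" if "x \<in> S" for x
      using diff_chain_at[OF f'[OF that] g'[OF that]] by (simp add: o_def flip: *[OF that])
    show "C_on k S (\<lambda>x. \<Sum>i\<in>Basis. (frechet_derivative f (at x) b \<bullet> i) *\<^sub>R 
           frechet_derivative g (at (f x)) i)" if "b \<in> Basis" for b
    proof (intro C_on_sum C_on_bilinear[OF bounded_bilinear_scaleR] C_on_linear[OF bounded_linear_inner_left] assms)
      show "C_on k S (\<lambda>x. frechet_derivative f (at x) b)" using Suc.prems that by simp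
      fix i :: 'b assume "i \<in> Basis"
      then have "C_on k S ((\<lambda>y. frechet_derivative g (at y) i) \<circ> f)"
        using Suc.prems by (intro Suc.IH) (auto intro: C_on_lower)
      then show "C_on k S (\<lambda>x. frechet_derivative g (at (f x)) i)" by (simp add: o_def)
    qed
  qed
qed

lemma C_on_Pair:
  assumes "open S" "C_on k S f" "C_on k S g"
  shows "C_on k S (\<lambda>x. (f x, g x))"
proof (rule C_on_cong[OF assms(1)])
  show "C_on k S (\<lambda>x. (f x, 0) + (0, g x))"
    by (intro C_on_add C_on_linear[of "\<lambda>x. (x, 0)"] C_on_linear[of "\<lambda>x. (0, x)"] assms
       bounded_linear_Pair bounded_linear_ident bounded_linear_zero)
qed auto

section \<open>Smooth bump functions\<close>

text \<open>The weight \<open>P\<close> makes this family closed under differentiation, which is what the induction on the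
  order of differentiability needs; the bump functions only use constant \<open>P\<close>.\<close>

definition flat :: "real poly \<Rightarrow> real \<Rightarrow> real" where
  "flat P x = (if x > 0 then poly P (1 / x) * exp (- (1 / x)) else 0)"

lemma flat_tendsto_0: "(flat P \<longlongrightarrow> 0) (at 0)"
proof -
  have "((\<lambda>y::real. \<Sum>i\<le>degree P. coeff P i * (y ^ i / exp y)) \<longlongrightarrow> (\<Sum>i\<le>degree P. coeff P i * 0)) at_top"
    by (intro tendsto_intros tendsto_power_div_exp_0)
  then have "((\<lambda>y. poly P y * exp (- y)) \<longlongrightarrow> 0) at_top"
    by (simp add: poly_altdef sum_divide_distrib exp_minus divide_inverse[symmetric])
  then have "((\<lambda>x. poly P (inverse x) * exp (- inverse x)) \<longlongrightarrow> 0) (at_right 0)"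
    by (rule filterlim_compose[OF _ filterlim_inverse_at_top_right])
  then have "(flat P \<longlongrightarrow> 0) (at_right 0)"
    by (rule Lim_transform_eventually)
      (auto simp: flat_def eventually_at_right_field divide_inverse intro: exI[of _ 1])
  moreover have "(flat P \<longlongrightarrow> 0) (at_left 0)"
    by (rule Lim_transform_eventually[OF tendsto_const])
      (auto simp: flat_def eventually_at_left_field intro: exI[of _ "-1"])
  ultimately show ?thesis by (simp add: filterlim_split_at)
qed

text \<open>For \<open>x > 0\<close> the derivative of \<open>P(1/x) exp(- 1/x)\<close> is \<open>(P - P')(1/x) / x\<^sup>2 exp(- 1/x)\<close>. At \<open>0\<close> the difference
  quotient is again a flat function, with weight \<open>y P(y)\<close>, and so tends to \<open>0\<close>.\<close>

lemma flat_has_derivative: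
  "(flat P has_real_derivative flat ([:0, 0, 1:] * (P - pderiv P)) x) (at x)"
proof (cases x "0::real" rule: linorder_cases)
  case less
  have "((\<lambda>_. 0) has_real_derivative 0) (at x)" by simp
  then have "(flat P has_real_derivative 0) (at x)"
    by (rule has_field_derivative_transform_within_open[where S = "{..<0}"]) (use less in \<open>auto simp: flat_def\<close>)
  then show ?thesis using less by (simp add: flat_def)
next
  case equal
  have "((\<lambda>h. flat P h / h) \<longlongrightarrow> 0) (at 0)"
    by (rule Lim_transform_eventually[OF flat_tendsto_0[of "[:0, 1:] * P"]])
      (auto simp: flat_def eventually_at_filter)
  then show ?thesis using equal by (simp add: DERIV_def flat_def)
next
  case greater
  have "((\<lambda>x. poly P (1 / x) * exp (- (1 / x))) has_real_derivative
          flat ([:0, 0, 1:] * (P - pderiv P)) x) (at x)"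
    using greater
    by (auto intro!: derivative_eq_intros DERIV_chain2[OF poly_DERIV] 
        simp: flat_def power2_eq_square algebra_simps)
  then show ?thesis
    by (rule has_field_derivative_transform_within_open[where S = "{0<..}"]) (use greater in \<open>auto simp: flat_def\<close>)
qed

lemma C_on_flat: "C_on k UNIV (flat P)"
proof (induction k arbitrary: P)
  case 0
  show ?case
    using flat_has_derivative by (auto intro!: continuous_at_imp_continuous_on DERIV_isCont)
next
  case (Suc k)
  show ?case
    by (rule C_on_Suc_intro[OF open_UNIV flat_has_derivative[unfolded has_field_derivative_def]])
      (use Suc in auto)
qed

text \<open>The bump is \<open>exp(1/r\<^sup>2) exp(- 1/q)\<close> where \<open>q x = r\<^sup>2 - \<bar>x - a\<bar>\<^sup>2\<close> is positive, that is on the ball, and \<open>0\<close>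
  elsewhere; the constant normalises its value at the centre.\<close>

lemma smooth_bump_exists:
  fixes a :: "'a::euclidean_space"
  assumes "r > 0"
  obtains \<beta> :: "'a \<Rightarrow> real"
  where "\<And>k S. open S \<Longrightarrow> C_on k S \<beta>" "\<beta> a = 1" "\<And>x. x \<notin> ball a r \<Longrightarrow> \<beta> x = 0"
proof
  define q where "q = (\<lambda>x::'a. r\<^sup>2 - (x - a) \<bullet> (x - a))"
  define \<beta> where "\<beta> = (\<lambda>x. flat [:exp (1 / r\<^sup>2):] (q x))"
  have q: "C_on k UNIV q" for k
  proof -
    have "C_on k UNIV (\<lambda>x. r\<^sup>2 + ((x - a) \<bullet> (- (x - a))))"
      by (intro C_on_add C_on_bilinear[OF bounded_bilinear_inner] C_on_const C_on_linear[of uminus]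
          C_on_add[of _ _ _ "\<lambda>_. - a", simplified] C_on_id open_UNIV bounded_linear_minus bounded_linear_ident)
    then show ?thesis unfolding q_def by (simp add: inner_diff_left inner_diff_right algebra_simps)
  qed
  have "C_on k UNIV \<beta>" for k
    using C_on_compose[OF open_UNIV open_UNIV _ q C_on_flat] by (simp add: \<beta>_def o_def)
  then show "C_on k S \<beta>" for k S by (rule C_on_subset) auto
  show "\<beta> a = 1" using assms by (simp add: \<beta>_def q_def flat_def flip: exp_add)
  show "\<beta> x = 0" if "x \<notin> ball a r" for x
  proof -
    have "r\<^sup>2 \<le> (norm (x - a))\<^sup>2" using that assms by (intro power_mono) (auto simp: dist_norm norm_minus_commute)
    then show ?thesis by (simp add: \<beta>_def q_def flat_def power2_norm_eq_inner)
  qed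
qed

section \<open>Second derivatives\<close>

text \<open>The mean value theorem in the direction \<open>u\<close> turns the second difference into \<open>h\<close> times the change of
  \<open>f' u\<close> along \<open>h v\<close>, and the differentiability of \<open>f' u\<close> at \<open>z\<close> evaluates that change up to \<open>o(h)\<close>.\<close>

lemma second_difference_quotient:
  fixes f :: "'a::real_normed_vector \<Rightarrow> real"
  assumes "open W" "z \<in> W" and f': "\<And>x. x \<in> W \<Longrightarrow> (f has_derivative f' x) (at x)"
    and A: "((\<lambda>x. f' x u) has_derivative A) (at z)"
  shows "((\<lambda>h. (f (z + h *\<^sub>R u + h *\<^sub>R v) - f (z + h *\<^sub>R u) - f (z + h *\<^sub>R v) + f z) / h\<^sup>2)
           \<longlongrightarrow> A v) (at_right 0)"
proof (rule tendstoI)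
  fix e :: real assume e: "e > 0"
  \<comment> \<open>all points of the parallelogram spanned by \<open>h u\<close> and \<open>h v\<close> are within \<open>h M\<close> of \<open>z\<close>\<close>
  define M where "M = norm u + norm v + 1"
  have M: "M > 0" by (simp add: M_def add_nonneg_pos)
  obtain d1 where d1: "d1 > 0" "ball z d1 \<subseteq> W" using assms(1,2) openE by blast
  have "e / (3 * M) > 0" using e M by simp
  then obtain d2 where d2: "d2 > 0"
    "\<And>y. norm (y - z) < d2 \<Longrightarrow> norm (f' y u - f' z u - A (y - z)) \<le> e / (3 * M) * norm (y - z)"
    using A unfolding has_derivative_at_alt by blast
  interpret A: linear A using A by (rule has_derivative_linear)
  define d where "d = min d1 d2 / M"
  have "d > 0" using d1 d2 M by (simp add: d_def)
  moreover have "dist ((f (z + h *\<^sub>R u + h *\<^sub>R v) - f (z + h *\<^sub>R u) - f (z + h *\<^sub>R v) + f z) / h\<^sup>2) (A v) < e"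
    if h: "0 < h" "h < d" for h
  proof -
    have hM: "h * M < min d1 d2" using h M by (simp add: d_def field_simps)
    have near: "norm (r *\<^sub>R u + s *\<^sub>R v) \<le> h * M" if "0 \<le> r" "r \<le> h" "0 \<le> s" "s \<le> h" for r s
    proof -
      have "norm (r *\<^sub>R u + s *\<^sub>R v) \<le> r * norm u + s * norm v"
        using that norm_triangle_ineq[of "r *\<^sub>R u" "s *\<^sub>R v"] by simp
      also have "\<dots> \<le> h * norm u + h * norm v" using that by (intro add_mono mult_right_mono) auto
      also have "\<dots> \<le> h * M" using h by (simp add: M_def algebra_simps)
      finally show ?thesis .
    qed
    have inW: "z + (r *\<^sub>R u + s *\<^sub>R v) \<in> W" if "0 \<le> r" "r \<le> h" "0 \<le> s" "s \<le> h" for r s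
    proof (rule subsetD[OF d1(2)])
      have "dist z (z + (r *\<^sub>R u + s *\<^sub>R v)) = norm (r *\<^sub>R u + s *\<^sub>R v)"
        by (metis add_diff_cancel_left' dist_commute dist_norm)
      then show "z + (r *\<^sub>R u + s *\<^sub>R v) \<in> ball z d1" using near[OF that] hM by simp
    qed
    have est: "norm (f' (z + (r *\<^sub>R u + s *\<^sub>R v)) u - f' z u - A (r *\<^sub>R u + s *\<^sub>R v)) \<le> e / 3 * h"
      if "0 \<le> r" "r \<le> h" "0 \<le> s" "s \<le> h" for r s
    proof -
      have "norm (f' (z + (r *\<^sub>R u + s *\<^sub>R v)) u - f' z u - A (r *\<^sub>R u + s *\<^sub>R v))
          \<le> e / (3 * M) * norm (r *\<^sub>R u + s *\<^sub>R v)"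
        using d2(2)[of "z + (r *\<^sub>R u + s *\<^sub>R v)"] near[OF that] hM by simp
      also have "\<dots> \<le> e / (3 * M) * (h * M)"
        using near[OF that] e M by (intro mult_left_mono) auto
      also have "\<dots> = e / 3 * h" using M by simp
      finally show ?thesis .
    qed
    define \<phi> where "\<phi> = (\<lambda>r. f (z + (r *\<^sub>R u + h *\<^sub>R v)) - f (z + (r *\<^sub>R u + 0 *\<^sub>R v)))"
    define \<phi>' where "\<phi>' = (\<lambda>r. f' (z + (r *\<^sub>R u + h *\<^sub>R v)) u - f' (z + (r *\<^sub>R u + 0 *\<^sub>R v)) u)"
    have line: "((\<lambda>r. f (z + (r *\<^sub>R u + s *\<^sub>R v))) has_real_derivative f' (z + (r *\<^sub>R u + s *\<^sub>R v)) u) (at r)"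
      if "0 \<le> r" "r \<le> h" "0 \<le> s" "s \<le> h" for r s
    proof -
      have "((\<lambda>r. z + (r *\<^sub>R u + s *\<^sub>R v)) has_derivative (\<lambda>k. k *\<^sub>R u)) (at r)"
        by (auto intro!: derivative_eq_intros)
      from diff_chain_at[OF this f'[OF inW[OF that]]]
      have "((\<lambda>r. f (z + (r *\<^sub>R u + s *\<^sub>R v))) has_derivative (\<lambda>k. f' (z + (r *\<^sub>R u + s *\<^sub>R v)) (k *\<^sub>R u))) (at r)"
        by (simp add: o_def)
      moreover have "(\<lambda>k. f' (z + (r *\<^sub>R u + s *\<^sub>R v)) (k *\<^sub>R u)) = (*) (f' (z + (r *\<^sub>R u + s *\<^sub>R v)) u)"
        using has_derivative_linear[OF f'[OF inW[OF that]]] by (auto simp: linear_cmul)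
      ultimately show ?thesis by (simp add: has_field_derivative_def)
    qed
    have "\<exists>r. 0 < r \<and> r < h \<and> \<phi> h - \<phi> 0 = (h - 0) * \<phi>' r"
    proof (rule MVT2)
      show "(\<phi> has_real_derivative \<phi>' r) (at r)" if "0 \<le> r" "r \<le> h" for r
        unfolding \<phi>_def \<phi>'_def by (intro DERIV_diff line) (use that h in auto)
    qed (use h in auto)
    then obtain r where r: "0 < r" "r < h" "\<phi> h - \<phi> 0 = h * \<phi>' r" by auto
    have "norm (\<phi>' r - h * A v) \<le> e / 3 * h + e / 3 * h"
    proof -
      have "\<phi>' r - h * A v = (f' (z + (r *\<^sub>R u + h *\<^sub>R v)) u - f' z u - A (r *\<^sub>R u + h *\<^sub>R v))
          - (f' (z + (r *\<^sub>R u + 0 *\<^sub>R v)) u - f' z u - A (r *\<^sub>R u + 0 *\<^sub>R v))"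
        by (simp add: \<phi>'_def A.add A.scale)
      also have "norm \<dots> \<le> e / 3 * h + e / 3 * h"
        by (rule order_trans[OF norm_triangle_ineq4 add_mono[OF est est]]) (use r h in auto)
      finally show ?thesis .
    qed
    then have "\<bar>\<phi>' r - h * A v\<bar> < e * h" using mult_pos_pos[OF e h(1)] by (simp add: field_simps)
    then have lt: "\<bar>\<phi>' r - h * A v\<bar> / h < e" using h by (simp add: pos_divide_less_eq)
    have eq: "(f (z + h *\<^sub>R u + h *\<^sub>R v) - f (z + h *\<^sub>R u) - f (z + h *\<^sub>R v) + f z) / h\<^sup>2 - A v
        = (\<phi>' r - h * A v) / h"
      using r h by (simp add: \<phi>_def field_simps power2_eq_square add.assoc)
    show ?thesis unfolding dist_real_def eq abs_divide using lt h by simp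
  qed
  ultimately show "\<forall>\<^sub>F h in at_right 0. dist ((f (z + h *\<^sub>R u + h *\<^sub>R v) - f (z + h *\<^sub>R u)
      - f (z + h *\<^sub>R v) + f z) / h\<^sup>2) (A v) < e"
    unfolding eventually_at_right_field by blast
qed

text \<open>The second difference quotient is symmetric in \<open>u\<close> and \<open>v\<close>, hence so is its limit.\<close>

lemma mixed_derivatives_commute:
  fixes f :: "'a::real_normed_vector \<Rightarrow> 'b::euclidean_space"
  assumes "open W" "z \<in> W" and f': "\<And>x. x \<in> W \<Longrightarrow> (f has_derivative f' x) (at x)"
    and A: "((\<lambda>x. f' x u) has_derivative A) (at z)"
    and B: "((\<lambda>x. f' x v) has_derivative B) (at z)"
  shows "A v = B u"
proof (rule euclidean_eqI)
  fix b :: 'b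
  have fb: "((\<lambda>x. f x \<bullet> b) has_derivative (\<lambda>h. f' x h \<bullet> b)) (at x)" if "x \<in> W" for x
    by (intro has_derivative_inner_left f'[OF that])
  have "((\<lambda>h. (f (z + h *\<^sub>R u + h *\<^sub>R v) \<bullet> b - f (z + h *\<^sub>R u) \<bullet> b - f (z + h *\<^sub>R v) \<bullet> b + f z \<bullet> b) / h\<^sup>2)
           \<longlongrightarrow> A v \<bullet> b) (at_right 0)"
    by (rule second_difference_quotient[OF assms(1,2) fb has_derivative_inner_left[OF A]])
  moreover have "((\<lambda>h. (f (z + h *\<^sub>R v + h *\<^sub>R u) \<bullet> b - f (z + h *\<^sub>R v) \<bullet> b - f (z + h *\<^sub>R u) \<bullet> b + f z \<bullet> b) / h\<^sup>2)
           \<longlongrightarrow> B u \<bullet> b) (at_right 0)"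
    by (rule second_difference_quotient[OF assms(1,2) fb has_derivative_inner_left[OF B]])
  then have "((\<lambda>h. (f (z + h *\<^sub>R u + h *\<^sub>R v) \<bullet> b - f (z + h *\<^sub>R u) \<bullet> b - f (z + h *\<^sub>R v) \<bullet> b + f z \<bullet> b) / h\<^sup>2)
           \<longlongrightarrow> B u \<bullet> b) (at_right 0)"
    by (simp add: algebra_simps)
  ultimately show "A v \<bullet> b = B u \<bullet> b"
    by (rule tendsto_unique[rotated]) simp
qed

lemma second_derivative_nonneg_at_min:
  fixes f :: "real \<Rightarrow> real"
  assumes "d > 0" and f': "\<And>x. \<bar>x\<bar> < d \<Longrightarrow> (f has_real_derivative f' x) (at x)"
    and "(f' has_real_derivative D) (at 0)" and min: "\<And>x. \<bar>x\<bar> < d \<Longrightarrow> f 0 \<le> f x"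
  shows "f' 0 = 0" "D \<ge> 0"
proof -
  show f'0: "f' 0 = 0"
    using DERIV_local_min[OF f'[of 0] assms(1)] assms(1) min by auto
  show "D \<ge> 0"
  proof (rule ccontr)
    assume "\<not> D \<ge> 0"
    then obtain e where e: "e > 0" "\<And>h. 0 < h \<Longrightarrow> h < e \<Longrightarrow> f' h < f' 0"
      using DERIV_neg_dec_right[OF assms(3)] by force
    define h where "h = min d e / 2"
    have h: "0 < h" "h < d" "h < e" using assms(1) e(1) by (auto simp: h_def)
    have "\<exists>r. 0 < r \<and> r < h \<and> f h - f 0 = (h - 0) * f' r"
      by (rule MVT2) (use h f' in auto)
    then obtain r where r: "0 < r" "r < h" "f h - f 0 = h * f' r" by auto
    then have "f h < f 0" using e(2)[of r] h f'0 by (simp add: mult_pos_neg algebra_simps)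
    with min[of h] h show False by auto
  qed
qed

section \<open>Isometries of Lorentzian products in coordinates\<close>

text \<open>The family \<open>g\<^sub>t\<close> of Riemannian metrics in a chart: \<open>G (t, x) u v\<close> is \<open>g\<^sub>t\<close> at \<open>x\<close>.\<close>

locale coordinate_metric =
  fixes W :: "(real \<times> 'e::euclidean_space) set" and G :: "real \<times> 'e \<Rightarrow> 'e \<Rightarrow> 'e \<Rightarrow> real"
  assumes open_domain: "open W"
    and bilinear: "z \<in> W \<Longrightarrow> bilinear (G z)"
    and sym: "z \<in> W \<Longrightarrow> G z u v = G z v u"
    and pos: "z \<in> W \<Longrightarrow> u \<noteq> 0 \<Longrightarrow> G z u u > 0"
    and diff: "z \<in> W \<Longrightarrow> (\<lambda>y. G y u v) differentiable (at z)"
begin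

lemma zero_left: "z \<in> W \<Longrightarrow> G z 0 v = 0"
  using bilinear bilinear_lzero by blast

lemma expand:
  assumes "z \<in> W"
  shows "G z u v = (\<Sum>i\<in>Basis. \<Sum>j\<in>Basis. (u \<bullet> i) * (v \<bullet> j) * G z i j)"
proof -
  have "linear (\<lambda>u. G z u v)" "\<And>i. linear (G z i)"
    using bilinear[OF assms] by (auto simp: bilinear_def)
  then have "G z u v = (\<Sum>i\<in>Basis. (u \<bullet> i) * (\<Sum>j\<in>Basis. (v \<bullet> j) * G z i j))"
    using linear_basis_expansion[of "\<lambda>u. G z u v" u] linear_basis_expansion[of "G z _" v] by simp
  then show ?thesis by (simp add: sum_distrib_left mult.assoc)
qed

text \<open>The product rule for a bilinear form that itself varies along \<open>\<Phi>\<close>: one term from the motion of the base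
  point with both arguments frozen, and one from each argument.\<close>

lemma has_derivative_along:
  fixes \<Phi> :: "'z::real_normed_vector \<Rightarrow> real \<times> 'e"
  assumes "(\<Phi> has_derivative \<Phi>') (at z)" and W: "\<Phi> z \<in> W"
    and p: "(p has_derivative p') (at z)" and q: "(q has_derivative q') (at z)"
  shows "((\<lambda>x. G (\<Phi> x) (p x) (q x)) has_derivative
     (\<lambda>h. frechet_derivative (\<lambda>y. G y (p z) (q z)) (at (\<Phi> z)) (\<Phi>' h)
          + G (\<Phi> z) (p' h) (q z) + G (\<Phi> z) (p z) (q' h))) (at z)"
proof -
  define g' where "g' i j = frechet_derivative (\<lambda>y. G y i j) (at (\<Phi> z))" for i j
  have g': "((\<lambda>y. G y i j) has_derivative g' i j) (at (\<Phi> z))" for i j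
    using diff[OF W] by (simp add: g'_def frechet_derivative_works)
  have g'_along: "((\<lambda>x. G (\<Phi> x) i j) has_derivative (\<lambda>h. g' i j (\<Phi>' h))) (at z)" for i j
    using diff_chain_at[OF assms(1) g'] by (simp add: o_def)
  have "((\<lambda>x. \<Sum>i\<in>Basis. \<Sum>j\<in>Basis. (p x \<bullet> i) * (q x \<bullet> j) * G (\<Phi> x) i j) has_derivative
     (\<lambda>h. \<Sum>i\<in>Basis. \<Sum>j\<in>Basis. (p z \<bullet> i) * (q z \<bullet> j) * g' i j (\<Phi>' h)
       + (p' h \<bullet> i) * (q z \<bullet> j) * G (\<Phi> z) i j + (p z \<bullet> i) * (q' h \<bullet> j) * G (\<Phi> z) i j)) (at z)"
    by (auto intro!: derivative_eq_intros p q g'_along simp: algebra_simps)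
  moreover have "frechet_derivative (\<lambda>y. G y u v) (at (\<Phi> z)) = (\<lambda>h. \<Sum>i\<in>Basis. \<Sum>j\<in>Basis. (u \<bullet> i) * (v \<bullet> j) * g' i j h)" for u v
  proof (rule frechet_derivative_eqI)
    have "((\<lambda>y. \<Sum>i\<in>Basis. \<Sum>j\<in>Basis. (u \<bullet> i) * (v \<bullet> j) * G y i j) has_derivative
        (\<lambda>h. \<Sum>i\<in>Basis. \<Sum>j\<in>Basis. (u \<bullet> i) * (v \<bullet> j) * g' i j h)) (at (\<Phi> z))"
      by (auto intro!: derivative_eq_intros g')
    then show "((\<lambda>y. G y u v) has_derivative
        (\<lambda>h. \<Sum>i\<in>Basis. \<Sum>j\<in>Basis. (u \<bullet> i) * (v \<bullet> j) * g' i j h)) (at (\<Phi> z))"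
      by (rule has_derivative_transform_within_open[OF _ open_domain W]) (simp add: expand[symmetric])
  qed
  ultimately have *: "((\<lambda>x. \<Sum>i\<in>Basis. \<Sum>j\<in>Basis. (p x \<bullet> i) * (q x \<bullet> j) * G (\<Phi> x) i j) has_derivative
     (\<lambda>h. frechet_derivative (\<lambda>y. G y (p z) (q z)) (at (\<Phi> z)) (\<Phi>' h)
          + G (\<Phi> z) (p' h) (q z) + G (\<Phi> z) (p z) (q' h))) (at z)"
    by (simp add: expand[OF W, of _ "q z"] expand[OF W, of "p z"] sum.distrib)
  obtain U where U: "open U" "z \<in> U" "\<And>x. x \<in> U \<Longrightarrow> \<Phi> x \<in> W"
  proof -
    have "\<forall>\<^sub>F x in nhds z. \<Phi> x \<in> W"
      using has_derivative_continuous[OF assms(1)] open_domain W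
      by (simp add: continuous_at topological_tendstoD tendsto_at_iff_tendsto_nhds)
    then show ?thesis using that unfolding eventually_nhds by blast
  qed
  show ?thesis
    by (rule has_derivative_transform_within_open[OF * U(1,2)]) (simp add: expand[OF U(3), symmetric])
qed

end

text \<open>A map \<open>\<Phi>\<close> that pulls \<open>- dt\<^sup>2 + G'\<close> back to \<open>- dt\<^sup>2 + G\<close>.\<close>

locale coordinate_isometry =
  src: coordinate_metric W G + tgt: coordinate_metric W' G'
  for W :: "(real \<times> 'e::euclidean_space) set" and G W' G' +
  fixes \<Phi> :: "real \<times> 'e \<Rightarrow> real \<times> 'e"
  assumes C2: "C_on 2 W \<Phi>"
    and maps: "z \<in> W \<Longrightarrow> \<Phi> z \<in> W'"
    and iso: "z \<in> W \<Longrightarrow>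
      - (fst (frechet_derivative \<Phi> (at z) u) * fst (frechet_derivative \<Phi> (at z) v))
        + G' (\<Phi> z) (snd (frechet_derivative \<Phi> (at z) u)) (snd (frechet_derivative \<Phi> (at z) v))
      = - (fst u * fst v) + G z (snd u) (snd v)"
begin

abbreviation D where "D z \<equiv> frechet_derivative \<Phi> (at z)"

lemma has_derivative_map: "z \<in> W \<Longrightarrow> (\<Phi> has_derivative D z) (at z)"
  using C2 by (simp add: numeral_2_eq_2 frechet_derivative_works)

lemma linear_D: "z \<in> W \<Longrightarrow> linear (D z)"
  using has_derivative_map has_derivative_linear by blast

lemma D_differentiable: "z \<in> W \<Longrightarrow> (\<lambda>y. D y u) differentiable (at z)"
  using C_on_directional_derivative[OF src.open_domain C2[unfolded numeral_2_eq_2] C_on_const[OF src.open_domain], of u]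
  by auto

text \<open>At a point where the time component of \<open>\<Phi>\<close> is critical along the slice of constant time, \<open>D\<Phi>\<close> sends
  slice vectors to slice vectors, isometrically and therefore onto. The image of \<open>\<partial>\<^sub>t\<close> is orthogonal to all
  of them, so it has no slice component, and its length forces it to be \<open>\<plusminus>\<partial>\<^sub>t\<close>.\<close>

lemma normal_at_critical_point:
  assumes z: "z \<in> W" and crit: "\<And>X. fst (D z (0, X)) = 0"
  shows "(fst (D z (1, 0)))\<^sup>2 = 1" "snd (D z (1, 0)) = 0"
proof -
  have G: "G' (\<Phi> z) (snd (D z (0, X))) (snd (D z (0, X))) = G z X X" for X
    using iso[OF z, of "(0, X)" "(0, X)"] crit by simp
  define L where "L X = snd (D z (0, X))" for X
  have L: "linear L"
    using linear_compose[OF _ linear_compose[OF linear_D[OF z] linear_snd], of "\<lambda>X. (0, X)"]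
    by (simp add: o_def L_def[abs_def] linear_iff)
  have "inj L"
    using G src.pos[OF z] tgt.zero_left[OF maps[OF z]]
    unfolding linear_injective_0[OF L] L_def by (metis less_irrefl)
  then have "surj L" using linear_injective_imp_surjective[OF L] by blast
  then obtain X where X: "L X = snd (D z (1, 0))" by (metis surjD)
  have "G' (\<Phi> z) (snd (D z (1, 0))) (snd (D z (1, 0))) = 0"
    using iso[OF z, of "(1, 0)" "(0, X)"] crit[of X] X src.zero_left[OF z] by (simp add: L_def)
  then show *: "snd (D z (1, 0)) = 0" using tgt.pos[OF maps[OF z]] by (metis less_irrefl)
  show "(fst (D z (1, 0)))\<^sup>2 = 1"
    using iso[OF z, of "(1, 0)" "(1, 0)"] * src.zero_left[OF z] tgt.zero_left[OF maps[OF z]]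
    by (simp add: power2_eq_square)
qed

text \<open>Write \<open>\<Phi> = (\<tau>, \<psi>)\<close> and \<open>Y = \<partial>\<^sub>X \<psi>\<close>. At \<open>z\<close>, where \<open>\<partial>\<^sub>X \<tau> = 0\<close> and \<open>\<partial>\<^sub>t \<psi> = 0\<close>, differentiating the isometry
  equation for the pair \<open>(X, X)\<close> in the direction \<open>\<partial>\<^sub>t\<close> gives
  \<open>\<epsilon> \<partial>\<^sub>t G'(Y, Y) + 2 G'(\<partial>\<^sub>t \<partial>\<^sub>X \<psi>, Y) = \<partial>\<^sub>t G(X, X)\<close>, and differentiating the one for \<open>(\<partial>\<^sub>t, X)\<close> in the direction \<open>X\<close>
  gives \<open>- \<epsilon> \<partial>\<^sub>X \<partial>\<^sub>X \<tau> + G'(\<partial>\<^sub>X \<partial>\<^sub>t \<psi>, Y) = 0\<close>. Mixed derivatives commute, so \<open>\<psi>\<close> can be eliminated. The result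
  compares the second fundamental forms of the slice and of its image, and its left-hand side is
  \<open>2 \<epsilon>\<close> times the Hessian of \<open>\<tau>\<close> on the slice.\<close>

lemma second_order_identity:
  fixes X :: 'e
  assumes z: "z \<in> W" and crit: "\<And>X. fst (D z (0, X)) = 0"
  defines "\<epsilon> \<equiv> fst (D z (1, 0))" and "Y \<equiv> snd (D z (0, X))"
  shows "2 * \<epsilon> * fst (frechet_derivative (\<lambda>y. D y (0, X)) (at z) (0, X))
    = frechet_derivative (\<lambda>y. G y X X) (at z) (1, 0)
      - \<epsilon> * frechet_derivative (\<lambda>y. G' y Y Y) (at (\<Phi> z)) (1, 0)"
proof -
  note n = normal_at_critical_point[OF z crit]
  define P where "P = frechet_derivative (\<lambda>y. D y (1, 0)) (at z)"
  define Q where "Q = frechet_derivative (\<lambda>y. D y (0, X)) (at z)"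
  have P: "((\<lambda>y. D y (1, 0)) has_derivative P) (at z)" and Q: "((\<lambda>y. D y (0, X)) has_derivative Q) (at z)"
    using D_differentiable[OF z] by (simp_all add: P_def Q_def frechet_derivative_works)
  have PQ: "P (0, X) = Q (1, 0)"
    by (rule mixed_derivatives_commute[OF src.open_domain z has_derivative_map P Q])
  have D1: "D z (1, 0) = \<epsilon> *\<^sub>R (1, 0)" using n(2) by (simp add: \<epsilon>_def prod_eq_iff)
  note fstI = bounded_linear.has_derivative[OF bounded_linear_fst]
  note sndI = bounded_linear.has_derivative[OF bounded_linear_snd]
  have "((\<lambda>y. - (fst (D y (0, X)) * fst (D y (0, X))) + G' (\<Phi> y) (snd (D y (0, X))) (snd (D y (0, X))))
     has_derivative (\<lambda>h. - (fst (D z (0, X)) * fst (Q h) + fst (Q h) * fst (D z (0, X)))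
       + (frechet_derivative (\<lambda>y. G' y Y Y) (at (\<Phi> z)) (D z h)
          + G' (\<Phi> z) (snd (Q h)) Y + G' (\<Phi> z) Y (snd (Q h))))) (at z)"
    unfolding Y_def
    by (intro has_derivative_add has_derivative_minus has_derivative_mult fstI sndI Q
        tgt.has_derivative_along[OF has_derivative_map[OF z] maps[OF z]])
  then have "((\<lambda>y. G y X X) has_derivative
       (\<lambda>h. - (fst (D z (0, X)) * fst (Q h) + fst (Q h) * fst (D z (0, X)))
       + (frechet_derivative (\<lambda>y. G' y Y Y) (at (\<Phi> z)) (D z h)
          + G' (\<Phi> z) (snd (Q h)) Y + G' (\<Phi> z) Y (snd (Q h))))) (at z)"
    by (rule has_derivative_transform_within_open[OF _ src.open_domain z])
      (use iso[of _ "(0, X)" "(0, X)"] in simp)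
  from frechet_derivative_eqI[OF this]
  have 1: "frechet_derivative (\<lambda>y. G y X X) (at z) (1, 0)
     = \<epsilon> * frechet_derivative (\<lambda>y. G' y Y Y) (at (\<Phi> z)) (1, 0) + 2 * G' (\<Phi> z) (snd (Q (1, 0))) Y"
    using linear_cmul[OF linear_frechet_derivative[OF tgt.diff[OF maps[OF z], of Y Y]], of \<epsilon> "(1, 0)"]
    by (simp add: crit D1 tgt.sym[OF maps[OF z], of Y])
  have "((\<lambda>y. - (fst (D y (1, 0)) * fst (D y (0, X))) + G' (\<Phi> y) (snd (D y (1, 0))) (snd (D y (0, X))))
     has_derivative (\<lambda>h. - (fst (D z (1, 0)) * fst (Q h) + fst (P h) * fst (D z (0, X)))
       + (frechet_derivative (\<lambda>y. G' y (snd (D z (1, 0))) (snd (D z (0, X)))) (at (\<Phi> z)) (D z h)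
          + G' (\<Phi> z) (snd (P h)) (snd (D z (0, X))) + G' (\<Phi> z) (snd (D z (1, 0))) (snd (Q h))))) (at z)"
    by (intro has_derivative_add has_derivative_minus has_derivative_mult fstI sndI P Q
        tgt.has_derivative_along[OF has_derivative_map[OF z] maps[OF z]])
  then have "((\<lambda>y. 0) has_derivative
     (\<lambda>h. - (fst (D z (1, 0)) * fst (Q h) + fst (P h) * fst (D z (0, X)))
       + (frechet_derivative (\<lambda>y. G' y (snd (D z (1, 0))) (snd (D z (0, X)))) (at (\<Phi> z)) (D z h)
          + G' (\<Phi> z) (snd (P h)) (snd (D z (0, X))) + G' (\<Phi> z) (snd (D z (1, 0))) (snd (Q h))))) (at z)"
    by (rule has_derivative_transform_within_open[OF _ src.open_domain z])
      (use iso[of _ "(1, 0)" "(0, X)"] src.zero_left in simp)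
  from has_derivative_unique[OF this has_derivative_const]
  have "(\<lambda>h. - (\<epsilon> * fst (Q h)) + frechet_derivative (\<lambda>y. G' y 0 Y) (at (\<Phi> z)) (D z h)
          + G' (\<Phi> z) (snd (P h)) Y) = (\<lambda>h. 0)"
    by (simp add: crit n(2) tgt.zero_left[OF maps[OF z]] algebra_simps flip: \<epsilon>_def Y_def)
  moreover have "frechet_derivative (\<lambda>y. G' y 0 Y) (at (\<Phi> z)) = (\<lambda>h. 0)"
    by (rule frechet_derivative_eqI, rule has_derivative_transform_within_open[OF has_derivative_const tgt.open_domain maps[OF z]])
      (simp add: tgt.zero_left)
  ultimately have 2: "\<epsilon> * fst (Q (0, X)) = G' (\<Phi> z) (snd (P (0, X))) Y"
    by (simp add: fun_eq_iff)
  show ?thesis using 1 2 PQ by (simp add: Q_def)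
qed

text \<open>The factor \<open>\<sigma>\<close> allows for maxima of the time component (\<open>\<sigma> = -1\<close>) as well as minima (\<open>\<sigma> = 1\<close>).\<close>

lemma slice_minimum:
  assumes z: "z \<in> W" and "d > 0"
    and min: "\<And>v. norm v < d \<Longrightarrow> \<sigma> * fst (\<Phi> z) \<le> \<sigma> * fst (\<Phi> (z + (0, v)))"
  shows "\<sigma> * fst (D z (0, X)) = 0"
    and "\<sigma> * fst (frechet_derivative (\<lambda>y. D y (0, X)) (at z) (0, X)) \<ge> 0"
proof -
  obtain e where e: "e > 0" "ball z e \<subseteq> W" using src.open_domain z openE by blast
  define l where "l r = z + r *\<^sub>R (0::real, X)" for r
  define d' where "d' = min d e / (norm X + 1)"
  have "norm X + 1 > 0" by (simp add: add_nonneg_pos)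
  then have d': "d' > 0" "d' * (norm X + 1) \<le> d" "d' * (norm X + 1) \<le> e" using assms(2) e by (auto simp: d'_def)
  have small: "norm (r *\<^sub>R X) < min d e" if "\<bar>r\<bar> < d'" for r
  proof -
    have "norm (r *\<^sub>R X) \<le> \<bar>r\<bar> * (norm X + 1)" by (simp add: algebra_simps)
    also have "\<dots> < d' * (norm X + 1)" using that by (intro mult_strict_right_mono) (auto simp: add_nonneg_pos)
    finally show ?thesis using d' by simp
  qed
  have lW: "l r \<in> W" if "\<bar>r\<bar> < d'" for r
  proof (rule subsetD[OF e(2)])
    have "dist z (l r) = norm (r *\<^sub>R X)"
      by (simp add: l_def dist_norm norm_prod_def)
    then show "l r \<in> ball z e" using small[OF that] by simp
  qed
  have l': "(l has_derivative (\<lambda>h. h *\<^sub>R (0, X))) (at r)" for r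
    unfolding l_def by (auto intro!: derivative_eq_intros)
  note fstI = bounded_linear.has_derivative[OF bounded_linear_fst]
  have 1: "((\<lambda>r. \<sigma> * fst (\<Phi> (l r))) has_real_derivative \<sigma> * fst (D (l r) (0, X))) (at r)" if "\<bar>r\<bar> < d'" for r
  proof -
    have "((\<lambda>r. \<sigma> * fst (\<Phi> (l r))) has_derivative (\<lambda>h. \<sigma> * fst (D (l r) (h *\<^sub>R (0, X))))) (at r)"
      using diff_chain_at[OF l' has_derivative_map[OF lW[OF that]]]
      by (intro has_derivative_mult_right fstI) (simp add: o_def)
    then show ?thesis unfolding has_field_derivative_def
      by (rule has_derivative_eq_rhs) (simp only: linear_cmul[OF linear_D[OF lW[OF that]]] fun_eq_iff, simp)
  qed
  have 2: "((\<lambda>r. \<sigma> * fst (D (l r) (0, X))) has_real_derivative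
      \<sigma> * fst (frechet_derivative (\<lambda>y. D y (0, X)) (at z) (0, X))) (at 0)"
  proof -
    let ?Q = "frechet_derivative (\<lambda>y. D y (0, X)) (at z)"
    have Q: "((\<lambda>y. D y (0, X)) has_derivative ?Q) (at (l 0))"
      using D_differentiable[OF z] by (simp add: frechet_derivative_works l_def flip: zero_prod_def)
    have "((\<lambda>r. \<sigma> * fst (D (l r) (0, X))) has_derivative (\<lambda>h. \<sigma> * fst (?Q (h *\<^sub>R (0, X))))) (at 0)"
      using diff_chain_at[OF l' Q]
      by (intro has_derivative_mult_right fstI) (simp add: o_def)
    then show ?thesis unfolding has_field_derivative_def
      by (rule has_derivative_eq_rhs) (simp only: linear_cmul[OF has_derivative_linear[OF Q]] fun_eq_iff, simp)
  qed
  have min': "\<sigma> * fst (\<Phi> (l 0)) \<le> \<sigma> * fst (\<Phi> (l r))" if "\<bar>r\<bar> < d'" for r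
    using min[of "r *\<^sub>R X"] small[OF that] by (simp add: l_def flip: zero_prod_def)
  show "\<sigma> * fst (D z (0, X)) = 0"
    "\<sigma> * fst (frechet_derivative (\<lambda>y. D y (0, X)) (at z) (0, X)) \<ge> 0"
    using second_derivative_nonneg_at_min[OF d'(1) 1 2 min'] by (auto simp: l_def simp flip: zero_prod_def)
qed

lemma normal_at_slice_minimum:
  assumes z: "z \<in> W" and "d > 0" and \<sigma>: "\<sigma>\<^sup>2 = 1"
    and min: "\<And>v. norm v < d \<Longrightarrow> \<sigma> * fst (\<Phi> z) \<le> \<sigma> * fst (\<Phi> (z + (0, v)))"
  shows "(fst (D z (1, 0)))\<^sup>2 = 1"
proof -
  have "\<sigma> \<noteq> 0" using \<sigma> by auto
  then have "fst (D z (0, X)) = 0" for X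
    using slice_minimum(1)[OF z assms(2) min] by simp
  then show ?thesis by (rule normal_at_critical_point(1)[OF z])
qed

text \<open>The signs \<open>\<delta>\<close> and \<open>\<sigma>\<close> tell on which end of spacetime \<open>z\<close> and its image lie, so that both metrics grow
  outwards; if \<open>\<sigma> \<epsilon> = - \<delta>\<close>, then \<open>\<Phi>\<close> sends the outward normal at \<open>z\<close> to the inward one. The second order identity
  multiplied by \<open>\<sigma> \<epsilon>\<close> then makes twice the Hessian of \<open>\<sigma> \<tau>\<close> equal to \<open>- \<delta> \<partial>\<^sub>t G(X, X) - \<sigma> \<partial>\<^sub>t G'(Y, Y) < 0\<close>, which is
  impossible at a minimum.\<close>

lemma no_slice_minimum_between_expansions:
  assumes z: "z \<in> W" and "d > 0" and \<sigma>: "\<sigma>\<^sup>2 = 1"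
    and min: "\<And>v. norm v < d \<Longrightarrow> \<sigma> * fst (\<Phi> z) \<le> \<sigma> * fst (\<Phi> (z + (0, v)))"
    and src_expands: "\<And>X. X \<noteq> 0 \<Longrightarrow> \<delta> * frechet_derivative (\<lambda>y. G y X X) (at z) (1, 0) > 0"
    and tgt_expands: "\<And>Y. \<sigma> * frechet_derivative (\<lambda>y. G' y Y Y) (at (\<Phi> z)) (1, 0) \<ge> 0"
  shows "\<sigma> * fst (D z (1, 0)) \<noteq> - \<delta>"
proof -
  have "\<sigma> \<noteq> 0" using \<sigma> by auto
  then have crit: "fst (D z (0, X)) = 0" for X
    using slice_minimum(1)[OF z assms(2) min] by simp
  have eps: "(fst (D z (1, 0)))\<^sup>2 = 1" by (rule normal_at_critical_point[OF z crit])
  show "\<sigma> * fst (D z (1, 0)) \<noteq> - \<delta>"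
  proof
    assume opp: "\<sigma> * fst (D z (1, 0)) = - \<delta>"
    obtain X :: 'e where "X \<in> Basis" using nonempty_Basis by blast
    then have X: "X \<noteq> 0" by auto
    define \<epsilon> where "\<epsilon> = fst (D z (1, 0))"
    define S where "S = frechet_derivative (\<lambda>y. G y X X) (at z) (1, 0)"
    define T where "T = frechet_derivative (\<lambda>y. G' y (snd (D z (0, X))) (snd (D z (0, X)))) (at (\<Phi> z)) (1, 0)"
    define H where "H = fst (frechet_derivative (\<lambda>y. D y (0, X)) (at z) (0, X))"
    have "2 * \<epsilon> * H = S - \<epsilon> * T"
      using second_order_identity[OF z crit, of X] by (simp add: \<epsilon>_def S_def T_def H_def)
    then have "\<sigma> * \<epsilon> * (2 * \<epsilon> * H) = \<sigma> * \<epsilon> * (S - \<epsilon> * T)" by simp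
    moreover have "\<epsilon> * \<epsilon> = 1" using eps by (simp add: \<epsilon>_def power2_eq_square)
    ultimately have "2 * (\<sigma> * H) = \<sigma> * \<epsilon> * S - \<sigma> * T" by algebra
    moreover have "\<sigma> * \<epsilon> = - \<delta>" using opp by (simp add: \<epsilon>_def)
    moreover have "\<sigma> * H \<ge> 0" using slice_minimum(2)[OF z assms(2) min] by (simp add: H_def)
    moreover have "\<delta> * S > 0" "\<sigma> * T \<ge> 0" using src_expands[OF X] tgt_expands by (auto simp: S_def T_def)
    ultimately show False by simp
  qed
qed

end

section \<open>Tangent vectors in charts\<close>

text \<open>The local part of the definition of a smooth manifold. It is separated from the global conditions on
  the topology because the tangent calculus is purely local, and is applied to \<open>F\<close>, to the real line
  and to spacetime alike.\<close>

locale smooth_atlas =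
  fixes X :: "'a topology" and A :: "('a, 'e::euclidean_space) chart set"
  assumes cover: "(\<Union>c\<in>A. fst c) = topspace X"
    and chart_open: "c \<in> A \<Longrightarrow> openin X (fst c)"
    and chart_inj: "c \<in> A \<Longrightarrow> inj_on (snd c) (fst c)"
    and chart_open_image: "c \<in> A \<Longrightarrow> openin X U \<Longrightarrow> U \<subseteq> fst c \<Longrightarrow> open (snd c ` U)"
    and transition_smooth: "c \<in> A \<Longrightarrow> d \<in> A \<Longrightarrow> smooth_on (snd c ` (fst c \<inter> fst d)) (snd d \<circ> chart_inv c)"
begin

lemma charts_atD: "c \<in> charts_at A p \<Longrightarrow> c \<in> A" "c \<in> charts_at A p \<Longrightarrow> p \<in> fst c"
  by (auto simp: charts_at_def)

lemma chart_at_exists: "p \<in> topspace X \<Longrightarrow> \<exists>c. c \<in> charts_at A p"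
  unfolding charts_at_def cover[symmetric] by blast

lemma chart_inv_left [simp]: "c \<in> A \<Longrightarrow> p \<in> fst c \<Longrightarrow> chart_inv c (snd c p) = p"
  by (simp add: chart_inv_def chart_inj inv_into_f_f)

lemma open_overlap:
  assumes "c \<in> A" "openin X U" shows "open (snd c ` (fst c \<inter> U))"
  using assms by (intro chart_open_image) (auto intro: openin_Int chart_open)

lemma transition_differentiable:
  assumes "c \<in> charts_at A p" "d \<in> charts_at A p"
  shows "(snd d \<circ> chart_inv c) differentiable (at (snd c p))"
proof -
  have "C_on 1 (snd c ` (fst c \<inter> fst d)) (snd d \<circ> chart_inv c)"
    using transition_smooth[OF charts_atD(1)[OF assms(1)] charts_atD(1)[OF assms(2)]]
    by (simp only: smooth_on_def)
  moreover have "snd c p \<in> snd c ` (fst c \<inter> fst d)" using assms by (auto simp: charts_at_def)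
  ultimately show ?thesis unfolding One_nat_def C_on.simps by blast
qed

text \<open>The chain rule for passing from the chart \<open>d\<close> to the chart \<open>c\<close>. It makes coordinate families of tangent
  vectors consistent, and differentials independent of the chart that is chosen at each point.\<close>

lemma change_of_chart:
  assumes c: "c \<in> charts_at A p" and d: "d \<in> charts_at A p"
    and g: "(g \<circ> chart_inv d) differentiable (at (snd d p))"
  shows "((g \<circ> chart_inv c) has_derivative
     frechet_derivative (g \<circ> chart_inv d) (at (snd d p)) \<circ> frechet_derivative (snd d \<circ> chart_inv c) (at (snd c p)))
     (at (snd c p))"
proof -
  note cd = charts_atD[OF c] charts_atD[OF d]
  have t: "((snd d \<circ> chart_inv c) has_derivative frechet_derivative (snd d \<circ> chart_inv c) (at (snd c p))) (at (snd c p))"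
    using transition_differentiable[OF c d] by (simp add: frechet_derivative_works)
  have "((g \<circ> chart_inv d) has_derivative frechet_derivative (g \<circ> chart_inv d) (at (snd d p)))
      (at ((snd d \<circ> chart_inv c) (snd c p)))"
    using g cd by (simp add: frechet_derivative_works)
  from diff_chain_at[OF t this] show ?thesis
    by (rule has_derivative_transform_within_open[OF _ open_overlap[OF cd(1) chart_open[OF cd(3)]]])
      (use cd in auto)
qed

lemma frechet_change_of_chart:
  assumes "c \<in> charts_at A p" "d \<in> charts_at A p" "(g \<circ> chart_inv d) differentiable (at (snd d p))"
  shows "frechet_derivative (g \<circ> chart_inv c) (at (snd c p)) u =
     frechet_derivative (g \<circ> chart_inv d) (at (snd d p)) (frechet_derivative (snd d \<circ> chart_inv c) (at (snd c p)) u)"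
  using frechet_derivative_eqI[OF change_of_chart[OF assms]] by simp

lemma coord_tvec_in_tangent_space:
  assumes c: "c \<in> charts_at A p"
  shows "coord_tvec A c p u \<in> tangent_space A p"
proof -
  have "coord_tvec A c p u e = frechet_derivative (snd e \<circ> chart_inv d) (at (snd d p)) (coord_tvec A c p u d)"
    if "d \<in> charts_at A p" "e \<in> charts_at A p" for d e
    unfolding coord_tvec_def using that
    by (simp only: if_True frechet_change_of_chart[OF c that(1) transition_differentiable[OF that]])
  moreover have "coord_tvec A c p u e = 0" if "e \<notin> charts_at A p" for e
    using that by (simp add: coord_tvec_def)
  ultimately show ?thesis unfolding tangent_space_def by blast
qed

lemma coord_tvec_self: 
  assumes "c \<in> charts_at A p"
  shows "coord_tvec A c p u c = u"
proof -
  note c = charts_atD[OF assms]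
  have "((snd c \<circ> chart_inv c) has_derivative (\<lambda>h. h)) (at (snd c p))"
    by (rule has_derivative_transform_within_open[OF has_derivative_ident open_overlap[OF c(1) chart_open[OF c(1)]]])
      (use c in auto)
  from frechet_derivative_eqI[OF this] show ?thesis using assms by (simp add: coord_tvec_def)
qed

lemma coord_tvec_linear:
  assumes "c \<in> charts_at A p"
  shows "coord_tvec A c p (a *\<^sub>R u + b *\<^sub>R v) = (\<lambda>d. a *\<^sub>R coord_tvec A c p u d + b *\<^sub>R coord_tvec A c p v d)"
  using linear_frechet_derivative[OF transition_differentiable[OF assms]]
  by (auto simp: coord_tvec_def linear_add linear_cmul)

end

lemma smooth_atlas_of_manifold:
  assumes "smooth_manifold X A"
  shows "smooth_atlas X A"
proof
  have A: "(\<Union>c\<in>A. fst c) = topspace X" "\<And>c. c \<in> A \<Longrightarrow> openin X (fst c)" "\<And>c. c \<in> A \<Longrightarrow> open (snd c ` fst c)"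
    "\<And>c. c \<in> A \<Longrightarrow> homeomorphic_map (subtopology X (fst c)) (top_of_set (snd c ` fst c)) (snd c)"
    "\<And>c d. c \<in> A \<Longrightarrow> d \<in> A \<Longrightarrow> smooth_on (snd c ` (fst c \<inter> fst d)) (snd d \<circ> chart_inv c)"
    using assms by (auto simp: smooth_manifold_def)
  show "(\<Union>c\<in>A. fst c) = topspace X" by (fact A)
  show "openin X (fst c)" if "c \<in> A" for c using A that by blast
  have ts: "topspace (subtopology X (fst c)) = fst c" if "c \<in> A" for c
    using A(2)[OF that] by (simp add: openin_subset inf.absorb2)
  show "inj_on (snd c) (fst c)" if "c \<in> A" for c
    using homeomorphic_imp_injective_map[OF A(4)[OF that]] ts[OF that] by simp
  show "open (snd c ` U)" if "c \<in> A" "openin X U" "U \<subseteq> fst c" for c U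
  proof -
    have "openin (subtopology X (fst c)) U" using that A(2) by (simp add: openin_open_subtopology)
    then have "openin (top_of_set (snd c ` fst c)) (snd c ` U)"
      using homeomorphic_imp_open_map[OF A(4)[OF that(1)]] by (simp add: open_map_def)
    then show ?thesis using A(3)[OF that(1)] openin_open_trans by blast
  qed
  show "smooth_on (snd c ` (fst c \<inter> fst d)) (snd d \<circ> chart_inv c)" if "c \<in> A" "d \<in> A" for c d
    using A(5) that by blast
qed

lemma smooth_map_charts:
  assumes "smooth_atlas X A" "smooth_map X A Y B f" "smooth_atlas Y B"
    and "c \<in> A" "d \<in> B"
  shows "open (snd c ` (fst c \<inter> f -` fst d))" "C_on k (snd c ` (fst c \<inter> f -` fst d)) (snd d \<circ> f \<circ> chart_inv c)"
proof -
  interpret X: smooth_atlas X A by fact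
  interpret Y: smooth_atlas Y B by fact
  have "openin X {p \<in> topspace X. f p \<in> fst d}"
    using assms(2) Y.chart_open[OF assms(5)] unfolding smooth_map_def by (blast intro: openin_continuous_map_preimage)
  from X.open_overlap[OF assms(4) this]
  have "open (snd c ` (fst c \<inter> {p \<in> topspace X. f p \<in> fst d}))" .
  moreover have "fst c \<inter> {p \<in> topspace X. f p \<in> fst d} = fst c \<inter> f -` fst d"
    using openin_subset[OF X.chart_open[OF assms(4)]] by blast
  ultimately show "open (snd c ` (fst c \<inter> f -` fst d))" by simp
  show "C_on k (snd c ` (fst c \<inter> f -` fst d)) (snd d \<circ> f \<circ> chart_inv c)"
    using assms(2,4,5) unfolding smooth_map_def smooth_on_def by blast
qed

text \<open>The differential is defined through an arbitrary chart at each point. This lemma trades it for a given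
  chart \<open>c\<close>, which is what allows differentials at varying points to be differentiated again.\<close>

lemma differential_coord_tvec:
  assumes X: "smooth_atlas X A" and Y: "smooth_atlas Y B" and f: "smooth_map X A Y B f"
    and c: "c \<in> charts_at A p" and d: "d \<in> charts_at B (f p)"
  shows "differential A B f p (coord_tvec A c p u) =
     coord_tvec B d (f p) (frechet_derivative (snd d \<circ> f \<circ> chart_inv c) (at (snd c p)) u)"
proof
  fix e
  interpret X: smooth_atlas X A by fact
  interpret Y: smooth_atlas Y B by fact
  have smooth: "(snd e \<circ> f \<circ> chart_inv c') differentiable (at (snd c' p))"
    if "c' \<in> charts_at A p" "e \<in> charts_at B (f p)" for c' e
  proof -
    have "C_on 1 (snd c' ` (fst c' \<inter> f -` fst e)) (snd e \<circ> f \<circ> chart_inv c')"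
      by (rule smooth_map_charts(2)[OF X f Y X.charts_atD(1)[OF that(1)] Y.charts_atD(1)[OF that(2)]])
    moreover have "snd c' p \<in> snd c' ` (fst c' \<inter> f -` fst e)" using that by (auto simp: charts_at_def)
    ultimately show ?thesis unfolding One_nat_def C_on.simps by blast
  qed
  show "differential A B f p (coord_tvec A c p u) e =
     coord_tvec B d (f p) (frechet_derivative (snd d \<circ> f \<circ> chart_inv c) (at (snd c p)) u) e"
  proof (cases "e \<in> charts_at B (f p)")
    case True
    define c' where "c' = (SOME c. c \<in> charts_at A p)"
    have c': "c' \<in> charts_at A p" unfolding c'_def using c by (rule someI)
    have "differential A B f p (coord_tvec A c p u) e =
       frechet_derivative (snd e \<circ> f \<circ> chart_inv c') (at (snd c' p)) (coord_tvec A c p u c')"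
      using True by (simp add: differential_def c'_def Let_def)
    also have "\<dots> = frechet_derivative (snd e \<circ> f \<circ> chart_inv c) (at (snd c p)) u"
      using X.frechet_change_of_chart[OF c c', of "snd e \<circ> f" u] smooth[OF c' True] c'
      by (simp add: coord_tvec_def o_assoc)
    also have "\<dots> = frechet_derivative (snd e \<circ> chart_inv d) (at (snd d (f p)))
        (frechet_derivative (snd d \<circ> f \<circ> chart_inv c) (at (snd c p)) u)"
    proof -
      note cd = X.charts_atD[OF c] Y.charts_atD[OF d] Y.charts_atD[OF True]
      have 1: "((snd d \<circ> f \<circ> chart_inv c) has_derivative frechet_derivative (snd d \<circ> f \<circ> chart_inv c) (at (snd c p))) (at (snd c p))"
        using smooth[OF c d] by (simp add: frechet_derivative_works)
      have 2: "((snd e \<circ> chart_inv d) has_derivative frechet_derivative (snd e \<circ> chart_inv d) (at (snd d (f p))))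
         (at ((snd d \<circ> f \<circ> chart_inv c) (snd c p)))"
        using Y.transition_differentiable[OF d True] cd by (simp add: frechet_derivative_works)
      have "((snd e \<circ> f \<circ> chart_inv c) has_derivative frechet_derivative (snd e \<circ> chart_inv d) (at (snd d (f p)))
          \<circ> frechet_derivative (snd d \<circ> f \<circ> chart_inv c) (at (snd c p))) (at (snd c p))"
        by (rule has_derivative_transform_within_open[OF diff_chain_at[OF 1 2] smooth_map_charts(1)[OF X f Y cd(1,3)]])
          (use cd in auto)
      from frechet_derivative_eqI[OF this] show ?thesis by simp
    qed
    finally show ?thesis using True by (simp add: coord_tvec_def)
  qed (simp add: differential_def coord_tvec_def)
qed

section \<open>Charts of spacetime\<close>

abbreviation spacetime_chart :: "('a, 'e) chart \<Rightarrow> (real \<times> 'a, real \<times> 'e) chart" where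
  "spacetime_chart c \<equiv> (UNIV \<times> fst c, map_prod id (snd c))"

lemma spacetime_atlas_eq: "spacetime_atlas A = spacetime_chart ` A"
proof (intro equalityI subsetI)
  fix C assume "C \<in> spacetime_atlas A"
  then obtain c d where "c = (UNIV, id)" "d \<in> A" "C = (fst c \<times> fst d, map_prod (snd c) (snd d))"
    unfolding product_atlas_def real_line_atlas_def by blast
  then show "C \<in> spacetime_chart ` A" by simp
next
  fix C assume "C \<in> spacetime_chart ` A"
  then obtain d where "d \<in> A" "C = spacetime_chart d" by blast
  then have "(UNIV, id) \<in> real_line_atlas \<and> d \<in> A"
    "C = (fst (UNIV :: real set, id :: real \<Rightarrow> real) \<times> fst d, map_prod (snd (UNIV :: real set, id :: real \<Rightarrow> real)) (snd d))"
    by (auto simp: real_line_atlas_def)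
  then show "C \<in> spacetime_atlas A" unfolding product_atlas_def by blast
qed

lemma map_prod_id_image: "map_prod id f ` (UNIV \<times> B) = UNIV \<times> f ` B"
  by (auto simp: image_iff Bex_def)

lemma smooth_atlas_real_line: "smooth_atlas euclideanreal real_line_atlas"
proof
  show "smooth_on (snd c ` (fst c \<inter> fst d)) (snd d \<circ> chart_inv c)"
    if "c \<in> real_line_atlas" "d \<in> real_line_atlas" for c d :: "(real, real) chart"
  proof -
    have "c = (UNIV, id)" "d = (UNIV, id)" using that by (auto simp: real_line_atlas_def)
    then show ?thesis by (simp add: smooth_on_def chart_inv_def id_def C_on_id comp_def inv_equality)
  qed
qed (auto simp: real_line_atlas_def)

context smooth_atlas
begin

lemma chart_inv_spacetime_chart:
  assumes "c \<in> A" "y \<in> snd c ` fst c"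
  shows "chart_inv (spacetime_chart c) (s, y) = (s, chart_inv c y)"
proof -
  obtain p where p: "p \<in> fst c" "y = snd c p" using assms by blast
  have "inj_on (map_prod id (snd c)) (UNIV \<times> fst c)"
    using chart_inj[OF assms(1)] by (auto simp: inj_on_def)
  then have "inv_into (UNIV \<times> fst c) (map_prod id (snd c)) (map_prod id (snd c) (s, p)) = (s, p)"
    using p by (intro inv_into_f_f) auto
  then show ?thesis using p assms by (simp add: chart_inv_def[of "spacetime_chart c"])
qed

lemma smooth_atlas_spacetime: "smooth_atlas (spacetime_topology X) (spacetime_atlas A)"
proof
  show "(\<Union>C\<in>spacetime_atlas A. fst C) = topspace (spacetime_topology X)"
    using cover by (auto simp: spacetime_atlas_eq)
  show "openin (spacetime_topology X) (fst C)" if "C \<in> spacetime_atlas A" for C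
    using that chart_open by (auto simp: spacetime_atlas_eq openin_prod_Times_iff)
  show "inj_on (snd C) (fst C)" if "C \<in> spacetime_atlas A" for C
    using that chart_inj by (auto simp: spacetime_atlas_eq inj_on_def)
  show "open (snd C ` U)" if C: "C \<in> spacetime_atlas A" and U: "openin (spacetime_topology X) U" "U \<subseteq> fst C" for C U
  proof -
    obtain c where c: "c \<in> A" "C = spacetime_chart c" using C unfolding spacetime_atlas_eq by blast
    show ?thesis
    proof (subst open_subopen, intro ballI)
      fix z assume "z \<in> snd C ` U"
      then obtain s p where z: "z = (s, snd c p)" "(s, p) \<in> U" using c by auto
      then have "\<exists>I V. openin euclideanreal I \<and> openin X V \<and> s \<in> I \<and> p \<in> V \<and> I \<times> V \<subseteq> U"
        using U(1) unfolding openin_prod_topology_alt by blast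
      then obtain I V where I: "openin euclideanreal I" and IV: "openin X V" "s \<in> I" "p \<in> V" "I \<times> V \<subseteq> U"
        by blast
      have "open I" using I by (rule open_openin[THEN iffD2])
      have "p \<in> fst c" using z(2) U(2) c by auto
      then have "z \<in> I \<times> snd c ` (fst c \<inter> V)" using z IV by auto
      moreover have "open (I \<times> snd c ` (fst c \<inter> V))"
        using open_Times[OF \<open>open I\<close> open_overlap[OF c(1) IV(1)]] .
      moreover have "I \<times> snd c ` (fst c \<inter> V) \<subseteq> snd C ` U"
      proof clarify
        fix t q assume "t \<in> I" "q \<in> fst c" "q \<in> V"
        then have "(t, q) \<in> U" using IV(4) by auto
        then show "(t, snd c q) \<in> snd C ` U" using c(2) by force
      qed
      ultimately show "\<exists>T. open T \<and> z \<in> T \<and> T \<subseteq> snd C ` U" by blast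
    qed
  qed
  show "smooth_on (snd C ` (fst C \<inter> fst E)) (snd E \<circ> chart_inv C)"
    if CE: "C \<in> spacetime_atlas A" "E \<in> spacetime_atlas A" for C E
  proof -
    obtain c d where c: "c \<in> A" "C = spacetime_chart c" and d: "d \<in> A" "E = spacetime_chart d"
      using CE unfolding spacetime_atlas_eq by blast
    let ?S = "UNIV \<times> snd c ` (fst c \<inter> fst d)"
    have op: "open (snd c ` (fst c \<inter> fst d))" by (rule open_overlap[OF c(1) chart_open[OF d(1)]])
    have "fst C \<inter> fst E = UNIV \<times> (fst c \<inter> fst d)" using c d by auto
    then have S: "snd C ` (fst C \<inter> fst E) = ?S" by (simp add: c map_prod_id_image)
    have opS: "open ?S" using op by (simp add: open_Times)
    have "C_on k ?S ((snd d \<circ> chart_inv c) \<circ> snd)" for k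
      using transition_smooth[OF c(1) d(1)]
      by (intro C_on_compose[OF opS op _ C_on_bounded_linear[OF bounded_linear_snd opS]])
        (auto simp: smooth_on_def)
    then have "C_on k ?S (\<lambda>z. (fst z, ((snd d \<circ> chart_inv c) \<circ> snd) z))" for k
      by (intro C_on_Pair[OF opS] C_on_bounded_linear[OF bounded_linear_fst opS])
    then have "C_on k ?S (snd E \<circ> chart_inv C)" for k
      by (rule C_on_cong[OF opS, rotated]) (auto simp: c d chart_inv_spacetime_chart[OF c(1)])
    then show ?thesis by (simp add: S smooth_on_def)
  qed
qed

lemma spacetime_chart_at:
  "c \<in> charts_at A p \<Longrightarrow> spacetime_chart c \<in> charts_at (spacetime_atlas A) (t, p)"
  by (auto simp: charts_at_def spacetime_atlas_eq)

lemma smooth_map_time: "smooth_map (spacetime_topology X) (spacetime_atlas A) euclideanreal real_line_atlas fst"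
  unfolding smooth_map_def
proof (intro conjI ballI)
  fix C :: "(real \<times> 'a, real \<times> 'e) chart" and d :: "(real, real) chart"
  assume "C \<in> spacetime_atlas A" "d \<in> real_line_atlas"
  then obtain c where c: "c \<in> A" "C = spacetime_chart c" unfolding spacetime_atlas_eq by blast
  have d: "d = (UNIV, id)" using \<open>d \<in> real_line_atlas\<close> by (simp add: real_line_atlas_def)
  have op: "open (UNIV \<times> snd c ` fst c)"
    using open_overlap[OF c(1) chart_open[OF c(1)]] by (simp add: open_Times)
  have S: "snd C ` (fst C \<inter> fst -` fst d) = UNIV \<times> snd c ` fst c"
    by (simp add: c d map_prod_id_image)
  have "C_on k (UNIV \<times> snd c ` fst c) (snd d \<circ> fst \<circ> chart_inv C)" for k
    by (rule C_on_cong[OF op _ C_on_bounded_linear[OF bounded_linear_fst op]])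
      (auto simp: c d chart_inv_spacetime_chart[OF c(1)])
  then show "smooth_on (snd C ` (fst C \<inter> fst -` fst d)) (snd d \<circ> fst \<circ> chart_inv C)"
    by (simp add: S smooth_on_def)
qed (rule continuous_map_fst)

lemma smooth_map_space: "smooth_map (spacetime_topology X) (spacetime_atlas A) X A snd"
  unfolding smooth_map_def
proof (intro conjI ballI)
  fix C :: "(real \<times> 'a, real \<times> 'e) chart" and d :: "('a, 'e) chart"
  assume "C \<in> spacetime_atlas A" and d: "d \<in> A"
  then obtain c where c: "c \<in> A" "C = spacetime_chart c" unfolding spacetime_atlas_eq by blast
  have op: "open (snd c ` (fst c \<inter> fst d))" by (rule open_overlap[OF c(1) chart_open[OF d(1)]])
  have opS: "open (UNIV \<times> snd c ` (fst c \<inter> fst d))" using op by (simp add: open_Times)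
  have S: "snd C ` (fst C \<inter> snd -` fst d) = UNIV \<times> snd c ` (fst c \<inter> fst d)"
  proof -
    have "fst C \<inter> snd -` fst d = UNIV \<times> (fst c \<inter> fst d)" using c by auto
    then show ?thesis by (simp add: c map_prod_id_image)
  qed
  have "C_on k (UNIV \<times> snd c ` (fst c \<inter> fst d)) ((snd d \<circ> chart_inv c) \<circ> snd)" for k
    using transition_smooth[OF c(1) d]
    by (intro C_on_compose[OF opS op _ C_on_bounded_linear[OF bounded_linear_snd opS]])
      (auto simp: smooth_on_def)
  then have "C_on k (UNIV \<times> snd c ` (fst c \<inter> fst d)) (snd d \<circ> snd \<circ> chart_inv C)" for k
    by (rule C_on_cong[OF opS, rotated])
      (auto simp: c d chart_inv_spacetime_chart[OF c(1)])
  then show "smooth_on (snd C ` (fst C \<inter> snd -` fst d)) (snd d \<circ> snd \<circ> chart_inv C)"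
    by (simp add: S smooth_on_def)
qed (rule continuous_map_snd)

text \<open>In a product chart the projections to the line and to \<open>F\<close> become \<open>fst\<close> and \<open>snd\<close>, so the metric takes its
  block form.\<close>

lemma lorentz_metric_coord_tvec:
  assumes c: "c \<in> charts_at A p"
  defines "C \<equiv> spacetime_chart c"
  shows "lorentz_metric A g (t, p) (coord_tvec (spacetime_atlas A) C (t, p) u) (coord_tvec (spacetime_atlas A) C (t, p) v)
    = - (fst u * fst v) + g t p (coord_tvec A c p (snd u)) (coord_tvec A c p (snd v))"
proof -
  interpret R: smooth_atlas euclideanreal real_line_atlas by (rule smooth_atlas_real_line)
  note cA = charts_atD[OF c]
  note C = spacetime_chart_at[OF c, of t, folded C_def]
  have op: "open (UNIV \<times> snd c ` fst c)"
    using open_overlap[OF cA(1) chart_open[OF cA(1)]] by (simp add: open_Times)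
  have zC: "snd C (t, p) = (t, snd c p)" "(t, snd c p) \<in> UNIV \<times> snd c ` fst c" using cA by (auto simp: C_def)
  have R: "(UNIV, id) \<in> charts_at real_line_atlas (fst (t, p))" by (simp add: charts_at_def real_line_atlas_def)
  have "((snd (UNIV, id) \<circ> fst \<circ> chart_inv C) has_derivative fst) (at (snd C (t, p)))"
    unfolding zC(1)
    by (rule has_derivative_transform_within_open[OF bounded_linear_imp_has_derivative[OF bounded_linear_fst] op zC(2)])
      (auto simp: C_def chart_inv_spacetime_chart[OF cA(1)])
  from frechet_derivative_eqI[OF this]
  have dt: "dt A (t, p) (coord_tvec (spacetime_atlas A) C (t, p) w) = fst w" for w
    unfolding dt_def differential_coord_tvec[OF smooth_atlas_spacetime smooth_atlas_real_line smooth_map_time C R]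
    using R.coord_tvec_self[OF R] by simp
  have "((snd c \<circ> snd \<circ> chart_inv C) has_derivative snd) (at (snd C (t, p)))"
    unfolding zC(1)
    by (rule has_derivative_transform_within_open[OF bounded_linear_imp_has_derivative[OF bounded_linear_snd] op zC(2)])
      (use cA in \<open>auto simp: C_def chart_inv_spacetime_chart[OF cA(1)]\<close>)
  from frechet_derivative_eqI[OF this]
  have "differential (spacetime_atlas A) A snd (t, p) (coord_tvec (spacetime_atlas A) C (t, p) w)
      = coord_tvec A c p (snd w)" for w
    using differential_coord_tvec[OF smooth_atlas_spacetime smooth_atlas_axioms smooth_map_space C, of c w] c by simp
  then show ?thesis by (simp add: lorentz_metric_def dt)
qed

end

section \<open>Extension of tangent vectors\<close>

text \<open>The ball is compact in the chart domain, hence compact in \<open>X\<close>, and \<open>X\<close> is Hausdorff. Closedness is what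
  makes fields supported in the ball extend smoothly by \<open>0\<close>.\<close>

lemma chart_ball_closedin:
  assumes "smooth_manifold X A" "c \<in> A" "cball y r \<subseteq> snd c ` fst c"
  shows "closedin X {q \<in> fst c. snd c q \<in> cball y r}"
proof -
  interpret smooth_atlas X A by (rule smooth_atlas_of_manifold[OF assms(1)])
  have hom: "homeomorphic_map (subtopology X (fst c)) (top_of_set (snd c ` fst c)) (snd c)"
    using assms(1,2) unfolding smooth_manifold_def by blast
  then obtain h where h: "homeomorphic_maps (subtopology X (fst c)) (top_of_set (snd c ` fst c)) (snd c) h"
    by (auto simp: homeomorphic_map_maps)
  have ts: "topspace (subtopology X (fst c)) = fst c"
    using openin_subset[OF chart_open[OF assms(2)]] by auto
  have hc: "continuous_map (top_of_set (snd c ` fst c)) (subtopology X (fst c)) h"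
    and hl: "\<And>q. q \<in> fst c \<Longrightarrow> h (snd c q) = q"
    using h ts by (auto simp: homeomorphic_maps_def)
  have "{q \<in> fst c. snd c q \<in> cball y r} = h ` cball y r"
  proof (intro equalityI subsetI)
    fix q assume "q \<in> {q \<in> fst c. snd c q \<in> cball y r}"
    then have "q = h (snd c q)" "snd c q \<in> cball y r" using hl by auto
    then show "q \<in> h ` cball y r" by (rule image_eqI)
  next
    fix q assume "q \<in> h ` cball y r"
    then obtain x where x: "x \<in> cball y r" "q = h x" by blast
    then obtain q' where "q' \<in> fst c" "x = snd c q'" using assms(3) by blast
    then show "q \<in> {q \<in> fst c. snd c q \<in> cball y r}" using x hl by auto
  qed
  moreover have "compactin (top_of_set (snd c ` fst c)) (cball y r)"
    using assms(3) by (simp add: compactin_subtopology)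
  then have "compactin (subtopology X (fst c)) (h ` cball y r)" using hc by (rule image_compactin)
  then have "compactin X (h ` cball y r)" by (simp add: compactin_subtopology)
  ultimately show ?thesis
    using assms(1) compactin_imp_closedin unfolding smooth_manifold_def by metis
qed

text \<open>The growth hypothesis speaks of vector fields on all of \<open>F\<close>, but it is needed for single tangent vectors.
  The vector \<open>u\<close> is extended constantly in the chart \<open>c\<close> and cut off by a bump function.\<close>

lemma tangent_vector_extends:
  assumes mfd: "smooth_manifold X A" and c: "c \<in> charts_at A p"
  obtains V where "smooth_vector_field X A V" "V p = coord_tvec A c p u"
proof -
  interpret smooth_atlas X A by (rule smooth_atlas_of_manifold[OF mfd])
  note cA = charts_atD[OF c]
  have "open (snd c ` fst c)" using chart_open_image[OF cA(1) chart_open[OF cA(1)]] by simp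
  then obtain r where r: "r > 0" "cball (snd c p) r \<subseteq> snd c ` fst c"
    using cA open_contains_cball by blast
  define K where "K = {q \<in> fst c. snd c q \<in> cball (snd c p) r}"
  have K: "closedin X K" unfolding K_def by (rule chart_ball_closedin[OF mfd cA(1) r(2)])
  obtain \<beta> :: "'b \<Rightarrow> real" where \<beta>: "\<And>k S. open S \<Longrightarrow> C_on k S \<beta>" "\<beta> (snd c p) = 1"
    "\<And>x. x \<notin> ball (snd c p) r \<Longrightarrow> \<beta> x = 0"
    using smooth_bump_exists[OF r(1)] by metis
  define V where "V q = (if q \<in> fst c then coord_tvec A c q (\<beta> (snd c q) *\<^sub>R u) else (\<lambda>d. 0))" for q
  have zero: "coord_tvec A c q 0 = (\<lambda>d. 0)" if "q \<in> fst c" for q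
    using coord_tvec_linear[of c q 0 0 0 0] cA(1) that by (simp add: charts_at_def)
  have zero_tangent: "(\<lambda>d. 0) \<in> tangent_space A q" for q
  proof -
    have "frechet_derivative (snd e \<circ> chart_inv d) (at (snd d q)) 0 = 0"
      if "d \<in> charts_at A q" "e \<in> charts_at A q" for d e
      using linear_0[OF linear_frechet_derivative[OF transition_differentiable[OF that]]] .
    then show ?thesis by (simp add: tangent_space_def)
  qed
  have "smooth_vector_field X A V" unfolding smooth_vector_field_def
  proof (intro conjI ballI)
    show "V q \<in> tangent_space A q" for q
      using zero_tangent coord_tvec_in_tangent_space[of c q] cA(1) by (simp add: V_def charts_at_def)
    show "smooth_on (snd d ` fst d) (\<lambda>x. V (chart_inv d x) d)" if d: "d \<in> A" for d
      unfolding smooth_on_def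
    proof (intro allI C_on_local)
      fix k y assume "y \<in> snd d ` fst d"
      then obtain q where q: "q \<in> fst d" "y = snd d q" by blast
      show "\<exists>T. open T \<and> y \<in> T \<and> C_on k T (\<lambda>x. V (chart_inv d x) d)"
      \<comment> \<open>near the chart domain the field has an explicit smooth formula; elsewhere it vanishes near \<open>q\<close>,
        because the support of the cut-off is closed\<close>
      proof (cases "q \<in> fst c")
        case True
        define T where "T = snd d ` (fst d \<inter> fst c)"
        define S where "S = snd c ` (fst c \<inter> fst d)"
        have T: "open T" "y \<in> T" using open_overlap[OF d chart_open[OF cA(1)]] q True by (auto simp: T_def)
        have S: "open S" using open_overlap[OF cA(1) chart_open[OF d]] by (simp add: S_def)
        define w where "w x = frechet_derivative (snd d \<circ> chart_inv c) (at x) (\<beta> x *\<^sub>R u)" for x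
        have "C_on (Suc k) S (snd d \<circ> chart_inv c)"
          using transition_smooth[OF cA(1) d] unfolding S_def smooth_on_def by blast
        then have "C_on k S w" unfolding w_def
          by (intro C_on_directional_derivative[OF S] C_on_bilinear[OF bounded_bilinear_scaleR S] C_on_const S \<beta>(1))
        moreover have "C_on k T (snd c \<circ> chart_inv d)"
          using transition_smooth[OF d cA(1)] unfolding T_def smooth_on_def by blast
        moreover have "(snd c \<circ> chart_inv d) ` T \<subseteq> S" using d by (auto simp: T_def S_def)
        ultimately have "C_on k T (w \<circ> (snd c \<circ> chart_inv d))"
          by (intro C_on_compose[OF T(1) S])
        then have "C_on k T (\<lambda>x. V (chart_inv d x) d)"
          by (rule C_on_cong[OF T(1), rotated])
            (use d in \<open>auto simp: T_def V_def w_def coord_tvec_def charts_at_def\<close>)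
        then show ?thesis using T by blast
      next
        case False
        define T where "T = snd d ` (fst d \<inter> (topspace X - K))"
        have "open T" unfolding T_def by (rule open_overlap[OF d]) (use K in \<open>simp add: closedin_def\<close>)
        moreover have "y \<in> T"
          using q False openin_subset[OF chart_open[OF d]] by (auto simp: T_def K_def)
        moreover have "C_on k T (\<lambda>x. V (chart_inv d x) d)"
        proof (rule C_on_cong[OF \<open>open T\<close> _ C_on_const[OF \<open>open T\<close>, of _ 0]])
          fix x assume "x \<in> T"
          then obtain q' where q': "q' \<in> fst d" "q' \<notin> K" "x = snd d q'" by (auto simp: T_def)
          then have "V q' = (\<lambda>d. 0)"
            using \<beta>(3)[of "snd c q'"] zero[of q'] by (auto simp: V_def K_def)
          then show "0 = V (chart_inv d x) d" using q' d by simp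
        qed
        ultimately show ?thesis by blast
      qed
    qed
  qed
  moreover have "V p = coord_tvec A c p u" using cA \<beta>(2) by (simp add: V_def)
  ultimately show ?thesis using that by blast
qed

section \<open>The metrics in a chart\<close>

definition metric_in_chart ::
    "('a, 'e::euclidean_space) chart set \<Rightarrow> (real \<Rightarrow> ('a, 'e) metric) \<Rightarrow> ('a, 'e) chart \<Rightarrow> real \<times> 'e \<Rightarrow> 'e \<Rightarrow> 'e \<Rightarrow> real"
  where "metric_in_chart A g c z u v = (let p = chart_inv c (snd z)
     in g (fst z) p (coord_tvec A c p u) (coord_tvec A c p v))"

lemma metric_in_chart_at:
  assumes "smooth_atlas X A" "c \<in> charts_at A p"
  shows "metric_in_chart A g c (t, snd c p) u v = g t p (coord_tvec A c p u) (coord_tvec A c p v)"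
  using smooth_atlas.chart_inv_left[OF assms(1)] assms(2) by (simp add: metric_in_chart_def charts_at_def)

lemma coordinate_metric_in_chart:
  assumes mfd: "smooth_manifold X A" and g: "smooth_family_of_metrics X A g" and c: "c \<in> A"
  shows "coordinate_metric (UNIV \<times> snd c ` fst c) (metric_in_chart A g c)"
proof
  interpret smooth_atlas X A by (rule smooth_atlas_of_manifold[OF mfd])
  have sb: "symmetric_bilinear_on_tangents X A (g t)" and
    pd: "\<And>p v. p \<in> topspace X \<Longrightarrow> v \<in> tangent_space A p \<Longrightarrow> v \<noteq> (\<lambda>c. 0) \<Longrightarrow> g t p v v > 0" for t
    using g by (auto simp: smooth_family_of_metrics_def riemannian_metric_def)
  have lin: "g t p (\<lambda>c. a *\<^sub>R u c + b *\<^sub>R v c) w = a * g t p u w + b * g t p v w"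
    and sy: "g t p u v = g t p v u"
    if "p \<in> topspace X" "u \<in> tangent_space A p" "v \<in> tangent_space A p" "w \<in> tangent_space A p" for t p u v w a b
    using sb[of t] that unfolding symmetric_bilinear_on_tangents_def by blast+
  show "open (UNIV \<times> snd c ` fst c)"
    using chart_open_image[OF c chart_open[OF c]] by (simp add: open_Times)
  fix z :: "real \<times> 'b" 
  {
    fix u v assume "z \<in> UNIV \<times> snd c ` fst c"
    then obtain t p where z: "z = (t, snd c p)" and p: "c \<in> charts_at A p" using c by (auto simp: charts_at_def)
    have pX: "p \<in> topspace X" using openin_subset[OF chart_open[OF c]] charts_atD(2)[OF p] by blast
    note G = metric_in_chart_at[OF smooth_atlas_axioms p, of g t, folded z]
    note T = coord_tvec_in_tangent_space[OF p]
    show symm: "metric_in_chart A g c z u v = metric_in_chart A g c z v u" for u v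
      unfolding G using sy[OF pX T T T] by blast
    have linear: "linear (\<lambda>u. metric_in_chart A g c z u w)" for w
    proof (rule linearI)
      show "metric_in_chart A g c z (u + v) w = metric_in_chart A g c z u w + metric_in_chart A g c z v w" for u v
        using coord_tvec_linear[OF p, of 1 u 1 v] lin[OF pX T T T, of t 1 u 1 v w] by (simp add: G)
      show "metric_in_chart A g c z (a *\<^sub>R u) w = a *\<^sub>R metric_in_chart A g c z u w" for a u
        using coord_tvec_linear[OF p, of a u 0 u] lin[OF pX T T T, of t a u 0 u w] by (simp add: G)
    qed
    moreover have "metric_in_chart A g c z w = (\<lambda>u. metric_in_chart A g c z u w)" for w
      by (rule ext) (rule symm)
    ultimately show "bilinear (metric_in_chart A g c z)"
      unfolding bilinear_def by metis
    show "metric_in_chart A g c z u u > 0" if "u \<noteq> 0"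
      unfolding G
    proof (rule pd[OF pX T])
      show "coord_tvec A c p u \<noteq> (\<lambda>c. 0)" using coord_tvec_self[OF p, of u] that by metis
    qed
    have "C_on 1 (UNIV \<times> snd c ` fst c) (\<lambda>(t, x). let p = chart_inv c x in g t p (coord_tvec A c p u) (coord_tvec A c p v))"
      using g c unfolding smooth_family_of_metrics_def smooth_on_def by blast
    moreover have "(\<lambda>(t, x). let p = chart_inv c x in g t p (coord_tvec A c p u) (coord_tvec A c p v))
        = (\<lambda>y. metric_in_chart A g c y u v)"
      by (auto simp: metric_in_chart_def)
    ultimately show "(\<lambda>y. metric_in_chart A g c y u v) differentiable (at z)"
      using \<open>z \<in> UNIV \<times> snd c ` fst c\<close> by auto
  }
qed

lemma metric_in_chart_expands:
  assumes mfd: "smooth_manifold X A" and g: "smooth_family_of_metrics X A g" and c: "c \<in> charts_at A p"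
    and expands: "\<And>V. smooth_vector_field X A V \<Longrightarrow> deriv_abs (\<lambda>s. g s p (V p) (V p)) t \<ge> b * g t p (V p) (V p)"
  shows "t / \<bar>t\<bar> * frechet_derivative (\<lambda>z. metric_in_chart A g c z u u) (at (t, snd c p)) (1, 0)
    \<ge> b * metric_in_chart A g c (t, snd c p) u u"
proof -
  interpret smooth_atlas X A by (rule smooth_atlas_of_manifold[OF mfd])
  note cA = charts_atD[OF c]
  interpret G: coordinate_metric "UNIV \<times> snd c ` fst c" "metric_in_chart A g c"
    by (rule coordinate_metric_in_chart[OF mfd g cA(1)])
  let ?D = "frechet_derivative (\<lambda>z. metric_in_chart A g c z u u) (at (t, snd c p))"
  obtain V where V: "smooth_vector_field X A V" "V p = coord_tvec A c p u"
    by (rule tangent_vector_extends[OF mfd c])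
  have D: "((\<lambda>z. metric_in_chart A g c z u u) has_derivative ?D) (at (t, snd c p))"
    using G.diff[of "(t, snd c p)" u u] cA(2) by (simp add: frechet_derivative_works)
  have "((\<lambda>s. (s, snd c p)) has_derivative (\<lambda>h. (h, 0))) (at t)"
    by (auto intro!: derivative_eq_intros)
  from diff_chain_at[OF this D]
  have "((\<lambda>s. metric_in_chart A g c (s, snd c p) u u) has_derivative (\<lambda>h. ?D (h, 0))) (at t)"
    by (simp add: o_def)
  moreover have "(\<lambda>h. ?D (h, 0)) = (*) (?D (1, 0))"
  proof
    show "?D (h, 0) = ?D (1, 0) * h" for h
      using linear_cmul[OF has_derivative_linear[OF D], of h "(1, 0)"] by (simp add: mult.commute)
  qed
  ultimately have "((\<lambda>s. metric_in_chart A g c (s, snd c p) u u) has_real_derivative ?D (1, 0)) (at t)"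
    by (simp add: has_field_derivative_def)
  then have "deriv (\<lambda>s. g s p (V p) (V p)) t = ?D (1, 0)"
    unfolding metric_in_chart_at[OF smooth_atlas_axioms c] V(2) by (rule DERIV_imp_deriv)
  then show ?thesis
    using expands[OF V(1)] by (simp add: deriv_abs_def V(2) metric_in_chart_at[OF smooth_atlas_axioms c])
qed

section \<open>Isometries do not displace the core\<close>

lemma coordinate_metric_subset:
  assumes "coordinate_metric W G" "open U" "U \<subseteq> W"
  shows "coordinate_metric U G"
proof -
  interpret coordinate_metric W G by fact
  show ?thesis
    using assms(2,3) bilinear sym pos diff by unfold_locales blast+
qed

lemma isometry_in_charts:
  assumes mfd: "smooth_manifold X A" and g: "smooth_family_of_metrics X A g"
    and f: "isometry (spacetime_topology X) (spacetime_atlas A) (lorentz_metric A g) f"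
    and c: "c \<in> A" and d: "d \<in> A"
  defines "W \<equiv> snd (spacetime_chart c) ` (fst (spacetime_chart c) \<inter> f -` fst (spacetime_chart d))"
  shows "coordinate_isometry W (metric_in_chart A g c) (UNIV \<times> snd d ` fst d) (metric_in_chart A g d)
     (snd (spacetime_chart d) \<circ> f \<circ> chart_inv (spacetime_chart c))"
proof -
  interpret smooth_atlas X A by (rule smooth_atlas_of_manifold[OF mfd])
  define C where "C = spacetime_chart c"
  define E where "E = spacetime_chart d"
  define \<Phi> where "\<Phi> = snd E \<circ> f \<circ> chart_inv C"
  interpret M: smooth_atlas "spacetime_topology X" "spacetime_atlas A" by (rule smooth_atlas_spacetime)
  have CE: "C \<in> spacetime_atlas A" "E \<in> spacetime_atlas A"
    using c d by (auto simp: spacetime_atlas_eq C_def E_def)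
  have sm: "smooth_map (spacetime_topology X) (spacetime_atlas A) (spacetime_topology X) (spacetime_atlas A) f"
    using f by (simp add: isometry_def diffeomorphism_def)
  have W: "W = snd C ` (fst C \<inter> f -` fst E)" by (simp add: W_def C_def E_def)
  note smooth = smooth_map_charts[OF M.smooth_atlas_axioms sm M.smooth_atlas_axioms CE, folded W \<Phi>_def]
  have Wsub: "W \<subseteq> UNIV \<times> snd c ` fst c" by (auto simp: W C_def)
  interpret src: coordinate_metric W "metric_in_chart A g c"
    by (rule coordinate_metric_subset[OF coordinate_metric_in_chart[OF mfd g c] smooth(1) Wsub])
  interpret tgt: coordinate_metric "UNIV \<times> snd d ` fst d" "metric_in_chart A g d"
    by (rule coordinate_metric_in_chart[OF mfd g d])
  have "coordinate_isometry W (metric_in_chart A g c) (UNIV \<times> snd d ` fst d) (metric_in_chart A g d) \<Phi>"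
  proof
    show "C_on 2 W \<Phi>" by (rule smooth(2))
    fix z assume "z \<in> W"
    then obtain t p where q: "(t, p) \<in> fst C" "f (t, p) \<in> fst E" "z = snd C (t, p)" unfolding W by auto
    obtain t' p' where fq: "f (t, p) = (t', p')" by fastforce
    have cp: "c \<in> charts_at A p" "d \<in> charts_at A p'"
      using q c d fq by (auto simp: C_def E_def charts_at_def)
    have z: "z = (t, snd c p)" using q(3) by (simp add: C_def)
    have \<Phi>z: "\<Phi> z = (t', snd d p')"
      using fq M.chart_inv_left[OF CE(1) q(1)] by (simp add: \<Phi>_def q(3)) (simp add: E_def)
    show "\<Phi> z \<in> UNIV \<times> snd d ` fst d" using \<Phi>z cp by (auto simp: charts_at_def)
    fix u v
    let ?D = "frechet_derivative \<Phi> (at z)"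
    note CEq = spacetime_chart_at[OF cp(1), of t, folded C_def] spacetime_chart_at[OF cp(2), of t', folded E_def fq]
    have diff: "differential (spacetime_atlas A) (spacetime_atlas A) f (t, p) (coord_tvec (spacetime_atlas A) C (t, p) w)
        = coord_tvec (spacetime_atlas A) E (f (t, p)) (?D w)" for w
      using differential_coord_tvec[OF M.smooth_atlas_axioms M.smooth_atlas_axioms sm CEq, of w]
      unfolding \<Phi>_def q(3) .
    have "(t, p) \<in> topspace (spacetime_topology X)"
      using openin_subset[OF M.chart_open[OF CE(1)]] q(1) by blast
    then have "lorentz_metric A g (f (t, p))
         (coord_tvec (spacetime_atlas A) E (f (t, p)) (?D u)) (coord_tvec (spacetime_atlas A) E (f (t, p)) (?D v))
       = lorentz_metric A g (t, p) (coord_tvec (spacetime_atlas A) C (t, p) u) (coord_tvec (spacetime_atlas A) C (t, p) v)"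
      using f M.coord_tvec_in_tangent_space[OF CEq(1)] unfolding isometry_def diff[symmetric] by blast
    then show "- (fst (?D u) * fst (?D v)) + metric_in_chart A g d (\<Phi> z) (snd (?D u)) (snd (?D v))
        = - (fst u * fst v) + metric_in_chart A g c z (snd u) (snd v)"
      unfolding fq C_def E_def lorentz_metric_coord_tvec[OF cp(1)] lorentz_metric_coord_tvec[OF cp(2)]
      by (simp add: z \<Phi>z[unfolded z] metric_in_chart_at[OF smooth_atlas_axioms cp(1)] metric_in_chart_at[OF smooth_atlas_axioms cp(2)])
  qed
  then show ?thesis by (simp add: \<Phi>_def C_def E_def)
qed

lemma constant_sign_on_connected:
  fixes f :: "'a \<Rightarrow> real"
  assumes "connectedin X K" "continuous_map X euclideanreal f" "a > 0"
    and "\<And>q. q \<in> K \<Longrightarrow> \<bar>f q\<bar> > a"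
  obtains \<sigma> :: real where "\<sigma> = 1 \<or> \<sigma> = -1" "\<And>q. q \<in> K \<Longrightarrow> \<sigma> * f q > a"
proof -
  have "connected (f ` K)"
    using connectedin_continuous_map_image[OF assms(2,1)] by simp
  then have iv: "is_interval (f ` K)" by (simp add: is_interval_connected_1)
  have "\<not> (f q > a \<and> f r < - a)" if "q \<in> K" "r \<in> K" for q r
  proof
    assume "f q > a \<and> f r < - a"
    then have "0 \<in> f ` K"
      using iv that assms(3) unfolding is_interval_1 by (meson image_eqI less_imp_le neg_less_0_iff_less order_less_trans)
    then show False using assms(3,4) by force
  qed
  moreover have "f q > a \<or> f q < - a" if "q \<in> K" for q
    using assms(4)[OF that] by (auto simp: abs_if split: if_splits)
  ultimately have "(\<forall>q\<in>K. f q > a) \<or> (\<forall>q\<in>K. f q < - a)" by blast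
  then show thesis
  proof
    assume "\<forall>q\<in>K. f q > a"
    then show thesis using that[of 1] by simp
  next
    assume "\<forall>q\<in>K. f q < - a"
    then show thesis using that[of "-1"] by fastforce
  qed
qed

text \<open>If \<open>f\<close> displaced the core \<open>K\<close>, it would send the connected set \<open>K\<close> into one of the two ends. The point of
  \<open>K\<close> whose image is closest to the core would lie on the boundary of \<open>K\<close> and violate
  \<open>no_slice_minimum_between_expansions\<close>. Minimising over the whole of \<open>K\<close>, rather than over one boundary slice,
  selects the right boundary component, so that it does not matter whether \<open>f\<close> preserves the direction
  of time.\<close>

lemma isometry_meets_core:
  fixes X :: "'a topology" and A :: "('a, 'e::euclidean_space) chart set"
  assumes mfd: "smooth_manifold X A" and "connected_space X" "compact_space X" "topspace X \<noteq> {}"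
    and g: "smooth_family_of_metrics X A g" and t0: "t0 > 0" and b: "b > 0"
    and expands: "\<And>V t p. smooth_vector_field X A V \<Longrightarrow> \<bar>t\<bar> \<ge> t0 \<Longrightarrow> p \<in> topspace X \<Longrightarrow>
           deriv_abs (\<lambda>s. g s p (V p) (V p)) t \<ge> 2 * b * g t p (V p) (V p)"
    and f: "isometry (spacetime_topology X) (spacetime_atlas A) (lorentz_metric A g) f"
  defines "K \<equiv> {- t0..t0} \<times> topspace X"
  shows "f ` K \<inter> K \<noteq> {}"
proof
  assume disjoint: "f ` K \<inter> K = {}"
  interpret smooth_atlas X A by (rule smooth_atlas_of_manifold[OF mfd])
  have cont: "continuous_map (spacetime_topology X) (spacetime_topology X) f"
    using f by (simp add: isometry_def diffeomorphism_def smooth_map_def)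
  define \<tau> where "\<tau> = fst \<circ> f"
  have \<tau>: "continuous_map (spacetime_topology X) euclideanreal \<tau>"
    unfolding \<tau>_def by (rule continuous_map_compose[OF cont continuous_map_fst])
  have fX: "snd (f q) \<in> topspace X" if "q \<in> K" for q
  proof -
    have "q \<in> topspace (spacetime_topology X)" using that by (auto simp: K_def)
    then have "f q \<in> topspace (spacetime_topology X)" using cont by (auto simp: continuous_map_def)
    then show ?thesis by (auto simp: mem_Times_iff)
  qed
  have big: "\<bar>\<tau> q\<bar> > t0" if "q \<in> K" for q
  proof (rule ccontr)
    assume "\<not> \<bar>\<tau> q\<bar> > t0"
    then have "f q \<in> K" using fX[OF that] by (auto simp: K_def \<tau>_def mem_Times_iff)
    then show False using disjoint that by blast
  qed
  have "connectedin (spacetime_topology X) K"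
    using assms(2) by (simp add: K_def connectedin_Times connectedin_topspace connected_Icc)
  then obtain \<sigma> where \<sigma>: "\<sigma> = 1 \<or> \<sigma> = -1" "\<And>q. q \<in> K \<Longrightarrow> \<sigma> * \<tau> q > t0"
    using constant_sign_on_connected[OF _ \<tau> t0 big] by blast
  have "compactin (spacetime_topology X) K"
    using assms(3) by (simp add: K_def compactin_Times compact_space_def)
  moreover have "continuous_map (spacetime_topology X) euclideanreal (\<lambda>q. \<sigma> * \<tau> q)"
    by (intro continuous_map_real_mult \<tau>) simp
  ultimately have "compact ((\<lambda>q. \<sigma> * \<tau> q) ` K)"
    using image_compactin by fastforce
  moreover have "K \<noteq> {}" using assms(4) t0 by (auto simp: K_def)
  ultimately obtain q where q: "q \<in> K" "\<And>r. r \<in> K \<Longrightarrow> \<sigma> * \<tau> q \<le> \<sigma> * \<tau> r"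
    using compact_attains_inf[of "(\<lambda>q. \<sigma> * \<tau> q) ` K"] by auto
  obtain s p where sp: "q = (s, p)" by fastforce
  have s: "\<bar>s\<bar> \<le> t0" and p: "p \<in> topspace X" using q(1) sp by (auto simp: K_def)
  obtain t' p' where fq: "f (s, p) = (t', p')" by fastforce
  have p': "p' \<in> topspace X" using fX[OF q(1)] fq sp by simp
  have t': "\<sigma> * t' > t0" using \<sigma>(2)[OF q(1)] fq sp by (simp add: \<tau>_def)
  obtain c where c: "c \<in> charts_at A p" using chart_at_exists[OF p] by blast
  obtain d where d: "d \<in> charts_at A p'" using chart_at_exists[OF p'] by blast
  note cA = charts_atD[OF c] and dA = charts_atD[OF d]
  define C where "C = spacetime_chart c"
  define E where "E = spacetime_chart d"
  define \<Phi> where "\<Phi> = snd E \<circ> f \<circ> chart_inv C"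
  define W where "W = snd C ` (fst C \<inter> f -` fst E)"
  interpret coordinate_isometry W "metric_in_chart A g c" "UNIV \<times> snd d ` fst d" "metric_in_chart A g d" \<Phi>
    unfolding W_def \<Phi>_def C_def E_def by (rule isometry_in_charts[OF mfd g f cA(1) dA(1)])
  define z where "z = (s, snd c p)"
  have z: "z \<in> W" using cA dA fq by (auto simp: W_def C_def E_def z_def intro!: image_eqI[of _ _ "(s, p)"])
  have chart_inv_C: "chart_inv C (t, snd c r) = (t, r)" if "r \<in> fst c" for t r
    using chart_inv_spacetime_chart[OF cA(1), of "snd c r" t] that cA(1) by (simp add: C_def)
  have fst_\<Phi>: "fst (\<Phi> (t, snd c r)) = \<tau> (t, r)" if "r \<in> fst c" for t r
    by (simp add: \<Phi>_def chart_inv_C[OF that] E_def \<tau>_def)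
  have \<Phi>z: "\<Phi> z = (t', snd d p')" 
    by (simp add: z_def \<Phi>_def chart_inv_C[OF cA(2)] fq) (simp add: E_def)
  have min: "\<sigma> * fst (\<Phi> z) \<le> \<sigma> * fst (\<Phi> (t, snd c r))" if "\<bar>t\<bar> \<le> t0" "r \<in> fst c" for t r
  proof -
    have "(t, r) \<in> K" using that openin_subset[OF chart_open[OF cA(1)]] by (auto simp: K_def)
    then show ?thesis using q(2) that cA(2) by (simp add: z_def fst_\<Phi> sp)
  qed
  have "open (snd c ` fst c)" using chart_open_image[OF cA(1) chart_open[OF cA(1)]] by simp
  then obtain e where e: "e > 0" "ball (snd c p) e \<subseteq> snd c ` fst c" using cA(2) openE by blast
  have slice_min: "\<sigma> * fst (\<Phi> z) \<le> \<sigma> * fst (\<Phi> (z + (0, v)))" if v: "norm v < e" for v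
  proof -
    have "snd c p + v \<in> ball (snd c p) e" using v by (simp add: dist_norm)
    then obtain r where r: "r \<in> fst c" "snd c p + v = snd c r" using e(2) by blast
    then have "z + (0, v) = (s, snd c r)" by (simp add: z_def)
    then show ?thesis using min[OF s r(1)] by simp
  qed
  have \<sigma>2: "\<sigma>\<^sup>2 = 1" using \<sigma>(1) by auto
  \<comment> \<open>\<open>\<sigma> \<tau>\<close> has slope \<open>\<plusminus>1\<close> in time at \<open>z\<close>, and \<open>\<delta>\<close> is the direction in which it decreases; by minimality that
    direction leaves \<open>K\<close>\<close>
  define \<delta> where "\<delta> = - (\<sigma> * fst (D z (1, 0)))"
  have eps: "(fst (D z (1, 0)))\<^sup>2 = 1" by (rule normal_at_slice_minimum[OF z e(1) \<sigma>2 slice_min])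
  then have \<delta>: "\<delta>\<^sup>2 = 1" using \<sigma>2 by (simp add: \<delta>_def power_mult_distrib)
  then have \<delta>cases: "\<delta> = 1 \<or> \<delta> = -1" by (simp add: power2_eq_1_iff)
  have s_boundary: "s = \<delta> * t0"
  proof (rule ccontr)
    assume "s \<noteq> \<delta> * t0"
    then have inside: "\<delta> * s < t0" using s \<delta>cases by auto
    define h where "h = (\<lambda>r. \<sigma> * fst (\<Phi> (z + r *\<^sub>R (\<delta>, 0))))"
    have l': "((\<lambda>r. z + r *\<^sub>R (\<delta>, 0)) has_derivative (\<lambda>k. k *\<^sub>R (\<delta>, 0))) (at 0)"
      by (auto intro!: derivative_eq_intros)
    have "(\<Phi> has_derivative D z) (at (z + 0 *\<^sub>R (\<delta>, 0)))" using has_derivative_map[OF z] by (simp flip: zero_prod_def)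
    from diff_chain_at[OF l' this]
    have "(h has_derivative (\<lambda>k. \<sigma> * fst (D z (k *\<^sub>R (\<delta>, 0))))) (at 0)"
      unfolding h_def by (intro has_derivative_mult_right bounded_linear.has_derivative[OF bounded_linear_fst]) (simp add: o_def)
    moreover have "(\<lambda>k. \<sigma> * fst (D z (k *\<^sub>R (\<delta>, 0)))) = (*) (- 1)"
    proof
      fix k
      have "D z (k *\<^sub>R (\<delta>, 0)) = (k * \<delta>) *\<^sub>R D z (1, 0)"
        using linear_cmul[OF linear_D[OF z], of "k * \<delta>" "(1, 0)"] by simp
      then have "\<sigma> * fst (D z (k *\<^sub>R (\<delta>, 0))) = - k * \<delta>\<^sup>2" by (simp add: \<delta>_def power2_eq_square)
      then show "\<sigma> * fst (D z (k *\<^sub>R (\<delta>, 0))) = (- 1) * k" using \<delta> by simp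
    qed
    ultimately have "(h has_real_derivative - 1) (at 0)" by (simp add: has_field_derivative_def)
    then obtain k where k: "k > 0" "\<And>r. 0 < r \<Longrightarrow> r < k \<Longrightarrow> h r < h 0"
      using DERIV_neg_dec_right[of h "-1" 0] by auto
    define r where "r = min (k / 2) (t0 - \<delta> * s)"
    have r: "0 < r" "r < k" "r \<le> t0 - \<delta> * s" using k(1) inside by (auto simp: r_def)
    have "\<bar>s + r * \<delta>\<bar> \<le> t0" using r s \<delta>cases by auto
    from min[OF this cA(2)] have "h 0 \<le> h r" by (simp add: h_def z_def)
    with k(2)[OF r(1,2)] show False by simp
  qed
  then have s_abs: "\<bar>s\<bar> = t0" "s / \<bar>s\<bar> = \<delta>" using \<delta>cases t0 by auto
  have t'_abs: "\<bar>t'\<bar> \<ge> t0" "t' / \<bar>t'\<bar> = \<sigma>" using \<sigma>(1) t' t0 by auto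
  \<comment> \<open>the growth hypothesis applies at both points, since \<open>z\<close> is at time \<open>\<plusminus>t0\<close> and its image is beyond that\<close>
  have src_grows: "\<delta> * frechet_derivative (\<lambda>y. metric_in_chart A g c y u u) (at z) (1, 0) > 0" if "u \<noteq> 0" for u
  proof -
    have "2 * b * metric_in_chart A g c z u u > 0" using b src.pos[OF z that] by simp
    also have "\<dots> \<le> s / \<bar>s\<bar> * frechet_derivative (\<lambda>y. metric_in_chart A g c y u u) (at z) (1, 0)"
      unfolding z_def by (rule metric_in_chart_expands[OF mfd g c]) (use expands s_abs(1) p in simp)
    finally show ?thesis unfolding s_abs(2) .
  qed
  have tgt_grows: "\<sigma> * frechet_derivative (\<lambda>y. metric_in_chart A g d y u u) (at (\<Phi> z)) (1, 0) \<ge> 0" for u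
  proof -
    have "0 \<le> 2 * b * metric_in_chart A g d (\<Phi> z) u u"
      using b tgt.pos[OF maps[OF z], of u] tgt.zero_left[OF maps[OF z]] by (cases "u = 0") auto
    also have "\<dots> \<le> t' / \<bar>t'\<bar> * frechet_derivative (\<lambda>y. metric_in_chart A g d y u u) (at (\<Phi> z)) (1, 0)"
      unfolding \<Phi>z by (rule metric_in_chart_expands[OF mfd g d]) (use expands t'_abs(1) p' in simp)
    finally show ?thesis unfolding t'_abs(2) .
  qed
  have "\<sigma> * fst (D z (1, 0)) \<noteq> - \<delta>"
    by (rule no_slice_minimum_between_expansions[OF z e(1) \<sigma>2 slice_min src_grows tgt_grows])
  then show False by (simp add: \<delta>_def)
qed

text \<open>Disposes of the degenerate case in which \<open>F\<close> is empty: all bijections of the empty set coincide.\<close>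

lemma finite_faithful_action_on_empty:
  assumes "faithful_action G {} \<phi>"
  shows "finite (carrier G)"
proof -
  interpret faithful_action G "{}" \<phi> by fact
  have "\<phi> ` carrier G \<subseteq> carrier (BijGroup {})"
    using group_hom by (auto simp: group_hom_def group_hom_axioms_def hom_def)
  also have "\<dots> \<subseteq> {\<lambda>x. undefined}" by (auto simp: BijGroup_def Bij_def)
  finally show ?thesis using finite_imageD[OF finite_subset faithful] by blast
qed

section \<open>The Calabi--Markus phenomenon\<close>

theorem theorem1p6:
  fixes F :: "'a topology"
    and A :: "('a, 'e::euclidean_space) chart set"
    and g :: "real \<Rightarrow> ('a, 'e) metric"
    and t0 c :: real
  assumes "smooth_manifold F A"
    and "connected_space F"
    and "compact_space F"
    and "smooth_family_of_metrics F A g"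
    and "t0 > 0" and "c > 0"
    and "\<And>V t p. smooth_vector_field F A V \<Longrightarrow> \<bar>t\<bar> \<ge> t0 \<Longrightarrow> p \<in> topspace F \<Longrightarrow>
           deriv_abs (\<lambda>s. g s p (V p) (V p)) t \<ge> 2 * c * g t p (V p) (V p)"
  shows "calabi_markus_phenomenon TYPE('g)
           (spacetime_topology F) (spacetime_atlas A) (lorentz_metric A g)"
  unfolding calabi_markus_phenomenon_def
proof (intro allI impI, elim conjE)
  fix G :: "'g monoid" and \<phi>
  assume isom: "acts_isometrically (spacetime_topology F) (spacetime_atlas A) (lorentz_metric A g) G \<phi>"
    and faithful: "faithful_action G (topspace (spacetime_topology F)) \<phi>"
    and pd: "properly_discontinuous (spacetime_topology F) G \<phi>"
  show "finite (carrier G)"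
  proof (cases "topspace F = {}")
    case True
    then show ?thesis using faithful by (intro finite_faithful_action_on_empty) simp
  next
    case False
    define K where "K = {- t0..t0} \<times> topspace F"
    have "compactin (spacetime_topology F) K"
      using assms(3) by (simp add: K_def compactin_Times compact_space_def)
    then have "finite {\<gamma> \<in> carrier G. \<phi> \<gamma> ` K \<inter> K \<noteq> {}}"
      using pd unfolding properly_discontinuous_def by blast
    moreover have "\<phi> \<gamma> ` K \<inter> K \<noteq> {}" if "\<gamma> \<in> carrier G" for \<gamma>
      unfolding K_def
    proof (rule isometry_meets_core[OF assms(1-3) False assms(4-6)])
      show "isometry (spacetime_topology F) (spacetime_atlas A) (lorentz_metric A g) (\<phi> \<gamma>)"
        using isom that by (simp add: acts_isometrically_def)
    qed (fact assms(7))
    then have "{\<gamma> \<in> carrier G. \<phi> \<gamma> ` K \<inter> K \<noteq> {}} = carrier G" by blast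
    ultimately show ?thesis by simp
  qed
qed

end
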